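(* Let $\mathfrak{g}$ be a Kac--Moody algebra over $\mathbb{C}$, let $\lambda\in\mathfrak{h}^*$, and let $0\to N_V\to M(\lambda)\to V\to0$ be an exact sequence of $\mathfrak{g}$-modules, where $N_V$ is a proper submodule of $M(\lambda)$ (so $V$ is a nonzero highest weight module with highest weight $\lambda$). Then $$\mathrm{wt}\,V=\mathrm{wt}\,M(\lambda)\quad\Longleftrightarrow\quad N_V\subseteq N(\lambda).$$
   Context: $\mathfrak{g}=\mathfrak{g}(A)$ is the Kac--Moody algebra of a generalized Cartan matrix $A$, with Cartan subalgebra $\mathfrak{h}$, simple roots $\Pi=\{\alpha_i\}_{i\in\mathcal{I}}$ and simple coroots $\alpha_i^\vee$ ($\mathcal{I}$ finite). $M(\lambda)$ is the Verma module with highest weight $\lambda$; $\mathrm{wt}\,V$ is the set of weights of $V$. For $x=\sum_i c_i\alpha_i$, $\mathrm{supp}(x)=\{i\in\mathcal{I}\mid c_i\neq0\}$ (and $\mathrm{supp}(0)=\emptyset$). The Dynkin subdiagram on $S\subset\mathcal{I}$ has an edge if $\langle\alpha_i,\alpha_j^\vee\rangle\ne0$ for some $i\ne j$ in $S$. $N(\lambda)$ is the largest proper submodule $N$ of $M(\lambda)$ with the property: if $\mu\in\mathrm{wt}\,N$, then the Dynkin subdiagram on $\mathrm{supp}(\lambda-\mu)$ has at least one edge. (It exists: it is the sum of all submodules of $M(\lambda)$ with this property, since $\mathrm{wt}(S+T)=\mathrm{wt}\,S\cup\mathrm{wt}\,T$.) *)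

theory Defs
  imports "HOL-Analysis.Analysis"
begin

section \<open>Generalized Cartan matrices and realizations\<close>

definition generalized_cartan_matrix :: "int ^ 'i ^ 'i \<Rightarrow> bool" where
  "generalized_cartan_matrix A \<longleftrightarrow>
     (\<forall>i. A $ i $ i = 2) \<and>
     (\<forall>i j. i \<noteq> j \<longrightarrow> A $ i $ j \<le> 0) \<and>
     (\<forall>i j. A $ i $ j = 0 \<longrightarrow> A $ j $ i = 0)"

abbreviation linear_functional ::
    "(complex \<Rightarrow> 'h \<Rightarrow> 'h) \<Rightarrow> ('h :: ab_group_add \<Rightarrow> complex) \<Rightarrow> bool" where
  "linear_functional smul \<mu> \<equiv> Vector_Spaces.linear smul (*) \<mu>"

text \<open>
  A realization \<open>(\<hh>, \<Pi>, \<Pi>\<^sup>\<or>)\<close>: the type \<open>'h\<close> is the Cartan subalgebra, \<open>\<alpha> i\<close> are the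
  simple roots and \<open>\<alpha>v i\<close> the simple coroots. Both families are required to be linearly
  independent as families. Since \<open>2n - rank A \<ge> n > 0\<close>, and \<open>dim\<close> is \<open>0\<close> for
  infinite-dimensional spaces, the last condition implies that \<open>'h\<close> is finite-dimensional.
\<close>

definition realization ::
    "int ^ 'i ^ 'i \<Rightarrow> (complex \<Rightarrow> 'h \<Rightarrow> 'h) \<Rightarrow> ('i \<Rightarrow> 'h \<Rightarrow> complex) \<Rightarrow>
     ('i \<Rightarrow> 'h :: ab_group_add) \<Rightarrow> bool" where
  "realization A smul \<alpha> \<alpha>v \<longleftrightarrow>
     vector_space smul \<and>
     (\<forall>i. linear_functional smul (\<alpha> i)) \<and>
     (\<forall>c. (\<forall>h. (\<Sum>i\<in>UNIV. c i * \<alpha> i h) = 0) \<longrightarrow> (\<forall>i. c i = 0)) \<and>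
     (\<forall>c. (\<Sum>i\<in>UNIV. smul (c i) (\<alpha>v i)) = 0 \<longrightarrow> (\<forall>i. c i = 0)) \<and>
     (\<forall>i j. \<alpha> j (\<alpha>v i) = of_int (A $ i $ j)) \<and>
     vector_space.dim smul (UNIV :: 'h set) =
       2 * CARD('i) - rank (\<chi> i j. complex_of_int (A $ i $ j))"

section \<open>Algebras given by generators and relations\<close>

text \<open>
  Terms denote elements of a (not necessarily associative) complex algebra generated by \<open>'x\<close>.
  \<open>alg_cong R\<close> is the smallest congruence that contains \<open>R\<close> and makes the quotient of the term
  algebra a complex vector space with a bilinear product, so that quotient is the algebra with
  generators \<open>'x\<close> and relations \<open>R\<close>.
\<close>

datatype 'x alg_term =
    Gen 'x
  | Zero
  | Plus "'x alg_term" "'x alg_term"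
  | Scale complex "'x alg_term"
  | Times "'x alg_term" "'x alg_term"

inductive alg_cong ::
    "('x alg_term \<Rightarrow> 'x alg_term \<Rightarrow> bool) \<Rightarrow> 'x alg_term \<Rightarrow> 'x alg_term \<Rightarrow> bool"
  for R where
  ac_rel: "R s t \<Longrightarrow> alg_cong R s t"
| ac_refl: "alg_cong R s s"
| ac_sym: "alg_cong R s t \<Longrightarrow> alg_cong R t s"
| ac_trans: "alg_cong R s t \<Longrightarrow> alg_cong R t u \<Longrightarrow> alg_cong R s u"
| ac_cong_Plus: "alg_cong R s s' \<Longrightarrow> alg_cong R t t' \<Longrightarrow> alg_cong R (Plus s t) (Plus s' t')"
| ac_cong_Scale: "alg_cong R s s' \<Longrightarrow> alg_cong R (Scale a s) (Scale a s')"
| ac_cong_Times: "alg_cong R s s' \<Longrightarrow> alg_cong R t t' \<Longrightarrow> alg_cong R (Times s t) (Times s' t')"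
| ac_plus_assoc: "alg_cong R (Plus (Plus s t) u) (Plus s (Plus t u))"
| ac_plus_commute: "alg_cong R (Plus s t) (Plus t s)"
| ac_plus_zero: "alg_cong R (Plus Zero s) s"
| ac_plus_minus: "alg_cong R (Plus s (Scale (-1) s)) Zero"
| ac_scale_plus: "alg_cong R (Scale a (Plus s t)) (Plus (Scale a s) (Scale a t))"
| ac_plus_scale: "alg_cong R (Scale (a + b) s) (Plus (Scale a s) (Scale b s))"
| ac_scale_scale: "alg_cong R (Scale a (Scale b s)) (Scale (a * b) s)"
| ac_scale_one: "alg_cong R (Scale 1 s) s"
| ac_times_plus: "alg_cong R (Times s (Plus t u)) (Plus (Times s t) (Times s u))"
| ac_plus_times: "alg_cong R (Times (Plus s t) u) (Plus (Times s u) (Times t u))"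
| ac_times_scale: "alg_cong R (Times s (Scale a t)) (Scale a (Times s t))"
| ac_scale_times: "alg_cong R (Times (Scale a s) t) (Scale a (Times s t))"

primrec alg_eval ::
    "(complex \<Rightarrow> 'a \<Rightarrow> 'a) \<Rightarrow> ('a \<Rightarrow> 'a \<Rightarrow> 'a) \<Rightarrow> ('x \<Rightarrow> 'a) \<Rightarrow> 'x alg_term \<Rightarrow> 'a :: ab_group_add"
  where
  "alg_eval smul mul gen (Gen x) = gen x"
| "alg_eval smul mul gen Zero = 0"
| "alg_eval smul mul gen (Plus s t) = alg_eval smul mul gen s + alg_eval smul mul gen t"
| "alg_eval smul mul gen (Scale a s) = smul a (alg_eval smul mul gen s)"
| "alg_eval smul mul gen (Times s t) =
     mul (alg_eval smul mul gen s) (alg_eval smul mul gen t)"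

text \<open>
  With \<open>lie_relation R\<close> as relations, the construction above gives the Lie algebra with generators
  \<open>'x\<close> and relations \<open>R\<close>; \<open>Times\<close> is the bracket.
\<close>

inductive lie_relation ::
    "('x alg_term \<Rightarrow> 'x alg_term \<Rightarrow> bool) \<Rightarrow> 'x alg_term \<Rightarrow> 'x alg_term \<Rightarrow> bool"
  for R where
  lr_rel: "R s t \<Longrightarrow> lie_relation R s t"
| lr_alternating: "lie_relation R (Times s s) Zero"
| lr_jacobi: "lie_relation R
     (Plus (Times s (Times t u)) (Plus (Times t (Times u s)) (Times u (Times s t)))) Zero"

text \<open>
  Ideals of the Lie algebra with generators \<open>'x\<close> and relations \<open>R\<close>, each represented by the set of
  all terms that denote one of its elements.
\<close>

definition presented_lie_ideal ::
    "('x alg_term \<Rightarrow> 'x alg_term \<Rightarrow> bool) \<Rightarrow> 'x alg_term set \<Rightarrow> bool" where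
  "presented_lie_ideal R I \<longleftrightarrow>
     (\<forall>s t. s \<in> I \<longrightarrow> alg_cong (lie_relation R) s t \<longrightarrow> t \<in> I) \<and>
     Zero \<in> I \<and>
     (\<forall>s\<in>I. \<forall>t\<in>I. Plus s t \<in> I) \<and>
     (\<forall>a. \<forall>s\<in>I. Scale a s \<in> I) \<and>
     (\<forall>s. \<forall>t\<in>I. Times s t \<in> I)"

section \<open>Kac--Moody algebras\<close>

locale lie_algebra = vector_space smul
  for smul :: "complex \<Rightarrow> 'g :: ab_group_add \<Rightarrow> 'g" +
  fixes bracket :: "'g \<Rightarrow> 'g \<Rightarrow> 'g"
  assumes bracket_add_left: "bracket (x + y) z = bracket x z + bracket y z"
    and bracket_add_right: "bracket x (y + z) = bracket x y + bracket x z"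
    and bracket_scale_left: "bracket (smul a x) y = smul a (bracket x y)"
    and bracket_scale_right: "bracket x (smul a y) = smul a (bracket x y)"
    and bracket_self: "bracket x x = 0"
    and jacobi: "bracket x (bracket y z) + bracket y (bracket z x) + bracket z (bracket x y) = 0"

definition lie_subalgebra ::
    "(complex \<Rightarrow> 'g \<Rightarrow> 'g) \<Rightarrow> ('g \<Rightarrow> 'g \<Rightarrow> 'g) \<Rightarrow> 'g :: ab_group_add set \<Rightarrow> bool" where
  "lie_subalgebra smul bracket S \<longleftrightarrow>
     module.subspace smul S \<and> (\<forall>x\<in>S. \<forall>y\<in>S. bracket x y \<in> S)"

datatype ('i, 'h) km_gen = Gen_e 'i | Gen_f 'i | Gen_h 'h

text \<open>
  The defining relations of the auxiliary Lie algebra \<open>\<gg>\<close>-tilde of \<open>A\<close>. The generators \<open>Gen_h h\<close>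
  come from a vector space, whose linear structure gives the first two relations.
\<close>

inductive km_relation ::
    "(complex \<Rightarrow> 'h \<Rightarrow> 'h) \<Rightarrow> ('i \<Rightarrow> 'h \<Rightarrow> complex) \<Rightarrow> ('i \<Rightarrow> 'h :: ab_group_add) \<Rightarrow>
     ('i, 'h) km_gen alg_term \<Rightarrow> ('i, 'h) km_gen alg_term \<Rightarrow> bool"
  for smul \<alpha> \<alpha>v where
  km_h_add: "km_relation smul \<alpha> \<alpha>v (Gen (Gen_h (x + y))) (Plus (Gen (Gen_h x)) (Gen (Gen_h y)))"
| km_h_scale: "km_relation smul \<alpha> \<alpha>v (Gen (Gen_h (smul a x))) (Scale a (Gen (Gen_h x)))"
| km_e_f_same: "km_relation smul \<alpha> \<alpha>v (Times (Gen (Gen_e i)) (Gen (Gen_f i))) (Gen (Gen_h (\<alpha>v i)))"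
| km_e_f_diff: "i \<noteq> j \<Longrightarrow> km_relation smul \<alpha> \<alpha>v (Times (Gen (Gen_e i)) (Gen (Gen_f j))) Zero"
| km_h_h: "km_relation smul \<alpha> \<alpha>v (Times (Gen (Gen_h x)) (Gen (Gen_h y))) Zero"
| km_h_e: "km_relation smul \<alpha> \<alpha>v
     (Times (Gen (Gen_h x)) (Gen (Gen_e i))) (Scale (\<alpha> i x) (Gen (Gen_e i)))"
| km_h_f: "km_relation smul \<alpha> \<alpha>v
     (Times (Gen (Gen_h x)) (Gen (Gen_f i))) (Scale (- \<alpha> i x) (Gen (Gen_f i)))"

text \<open>Ideals of the auxiliary algebra that meet the Cartan subalgebra trivially.\<close>

definition cartan_avoiding_ideal ::
    "(complex \<Rightarrow> 'h \<Rightarrow> 'h) \<Rightarrow> ('i \<Rightarrow> 'h \<Rightarrow> complex) \<Rightarrow> ('i \<Rightarrow> 'h :: ab_group_add) \<Rightarrow>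
     ('i, 'h) km_gen alg_term set \<Rightarrow> bool" where
  "cartan_avoiding_ideal smul \<alpha> \<alpha>v I \<longleftrightarrow>
     presented_lie_ideal (km_relation smul \<alpha> \<alpha>v) I \<and>
     (\<forall>h. Gen (Gen_h h) \<in> I \<longrightarrow>
        alg_cong (lie_relation (km_relation smul \<alpha> \<alpha>v)) (Gen (Gen_h h)) Zero)"

text \<open>
  The Lie algebra on \<open>'g\<close>, with Chevalley generators and Cartan subalgebra given by \<open>gen\<close>, is
  (a copy of) \<open>\<gg>(A)\<close>: the canonical map from the auxiliary algebra is onto, and its kernel is the
  largest ideal that meets the Cartan subalgebra trivially.
\<close>

definition kac_moody_algebra ::
    "(complex \<Rightarrow> 'h \<Rightarrow> 'h) \<Rightarrow> ('i \<Rightarrow> 'h \<Rightarrow> complex) \<Rightarrow> ('i \<Rightarrow> 'h :: ab_group_add) \<Rightarrow>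
     (complex \<Rightarrow> 'g \<Rightarrow> 'g) \<Rightarrow> ('g \<Rightarrow> 'g \<Rightarrow> 'g) \<Rightarrow> (('i, 'h) km_gen \<Rightarrow> 'g :: ab_group_add) \<Rightarrow> bool"
  where
  "kac_moody_algebra scale_h \<alpha> \<alpha>v scale_g bracket gen \<longleftrightarrow>
     lie_algebra scale_g bracket \<and>
     surj (alg_eval scale_g bracket gen) \<and>
     (let kernel = {t. alg_eval scale_g bracket gen t = 0}
      in cartan_avoiding_ideal scale_h \<alpha> \<alpha>v kernel \<and>
         (\<forall>I. cartan_avoiding_ideal scale_h \<alpha> \<alpha>v I \<longrightarrow> I \<subseteq> kernel))"

section \<open>Modules and weights\<close>

locale lie_module = lie_algebra scale_g bracket + M: vector_space scale_M
  for scale_g :: "complex \<Rightarrow> 'g :: ab_group_add \<Rightarrow> 'g"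
    and bracket :: "'g \<Rightarrow> 'g \<Rightarrow> 'g"
    and scale_M :: "complex \<Rightarrow> 'm :: ab_group_add \<Rightarrow> 'm" +
  fixes act :: "'g \<Rightarrow> 'm \<Rightarrow> 'm"
  assumes act_add_left: "act (x + y) v = act x v + act y v"
    and act_add_right: "act x (v + w) = act x v + act x w"
    and act_scale_left: "act (scale_g a x) v = scale_M a (act x v)"
    and act_scale_right: "act x (scale_M a v) = scale_M a (act x v)"
    and act_bracket: "act (bracket x y) v = act x (act y v) - act y (act x v)"

definition lie_submodule ::
    "(complex \<Rightarrow> 'm \<Rightarrow> 'm) \<Rightarrow> ('g \<Rightarrow> 'm \<Rightarrow> 'm) \<Rightarrow> 'm :: ab_group_add set \<Rightarrow> bool" where
  "lie_submodule smul act N \<longleftrightarrow>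
     module.subspace smul N \<and> (\<forall>x. \<forall>v\<in>N. act x v \<in> N)"

definition lie_module_hom ::
    "(complex \<Rightarrow> 'm \<Rightarrow> 'm) \<Rightarrow> ('g \<Rightarrow> 'm \<Rightarrow> 'm) \<Rightarrow> (complex \<Rightarrow> 'v \<Rightarrow> 'v) \<Rightarrow> ('g \<Rightarrow> 'v \<Rightarrow> 'v) \<Rightarrow>
     ('m :: ab_group_add \<Rightarrow> 'v :: ab_group_add) \<Rightarrow> bool" where
  "lie_module_hom scale_M act_M scale_V act_V p \<longleftrightarrow>
     Vector_Spaces.linear scale_M scale_V p \<and> (\<forall>x v. p (act_M x v) = act_V x (p v))"

text \<open>The weights of a submodule \<open>N\<close>; \<open>N = UNIV\<close> gives the weights of the whole module.\<close>

definition weights ::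
    "(complex \<Rightarrow> 'h \<Rightarrow> 'h) \<Rightarrow> (('i, 'h) km_gen \<Rightarrow> 'g) \<Rightarrow>
     (complex \<Rightarrow> 'm \<Rightarrow> 'm) \<Rightarrow> ('g \<Rightarrow> 'm \<Rightarrow> 'm) \<Rightarrow> 'm :: ab_group_add set \<Rightarrow>
     ('h :: ab_group_add \<Rightarrow> complex) set" where
  "weights scale_h gen smul act N =
     {\<mu>. linear_functional scale_h \<mu> \<and>
         (\<exists>v\<in>N. v \<noteq> 0 \<and> (\<forall>h. act (gen (Gen_h h)) v = smul (\<mu> h) v))}"

section \<open>Verma modules\<close>

text \<open>
  The universal enveloping algebra is the unital associative algebra generated by the elements of
  the Lie algebra, with the relations below; its unit is one more generator.
\<close>

datatype 'g env_gen = Unit | Elem 'g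

inductive env_relation ::
    "(complex \<Rightarrow> 'g \<Rightarrow> 'g) \<Rightarrow> ('g \<Rightarrow> 'g \<Rightarrow> 'g) \<Rightarrow>
     'g :: ab_group_add env_gen alg_term \<Rightarrow> 'g env_gen alg_term \<Rightarrow> bool"
  for smul bracket where
  env_assoc: "env_relation smul bracket (Times (Times s t) u) (Times s (Times t u))"
| env_unit_left: "env_relation smul bracket (Times (Gen Unit) s) s"
| env_unit_right: "env_relation smul bracket (Times s (Gen Unit)) s"
| env_elem_add: "env_relation smul bracket
     (Gen (Elem (x + y))) (Plus (Gen (Elem x)) (Gen (Elem y)))"
| env_elem_scale: "env_relation smul bracket (Gen (Elem (smul a x))) (Scale a (Gen (Elem x)))"
| env_elem_bracket: "env_relation smul bracket
     (Gen (Elem (bracket x y)))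
     (Plus (Times (Gen (Elem x)) (Gen (Elem y))) (Scale (-1) (Times (Gen (Elem y)) (Gen (Elem x)))))"

primrec env_act ::
    "(complex \<Rightarrow> 'm \<Rightarrow> 'm) \<Rightarrow> ('g \<Rightarrow> 'm \<Rightarrow> 'm) \<Rightarrow> 'g env_gen alg_term \<Rightarrow> 'm \<Rightarrow> 'm :: ab_group_add"
  where
  "env_act smul act (Gen x) v = (case x of Unit \<Rightarrow> v | Elem y \<Rightarrow> act y v)"
| "env_act smul act Zero v = 0"
| "env_act smul act (Plus s t) v = env_act smul act s v + env_act smul act t v"
| "env_act smul act (Scale a s) v = smul a (env_act smul act s v)"
| "env_act smul act (Times s t) v = env_act smul act s (env_act smul act t v)"

definition n_plus ::
    "(complex \<Rightarrow> 'g \<Rightarrow> 'g) \<Rightarrow> ('g \<Rightarrow> 'g \<Rightarrow> 'g) \<Rightarrow> (('i, 'h) km_gen \<Rightarrow> 'g :: ab_group_add) \<Rightarrow> 'g set"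
  where
  "n_plus smul bracket gen = lie_subalgebra smul bracket hull range (\<lambda>i. gen (Gen_e i))"

text \<open>
  The left ideal of the enveloping algebra generated by \<open>\<nn>\<^sup>+\<close> and all \<open>h - \<Lambda>(h)\<close>, represented by
  the set of all terms that denote one of its elements.
\<close>

inductive_set verma_ideal ::
    "(complex \<Rightarrow> 'g \<Rightarrow> 'g) \<Rightarrow> ('g \<Rightarrow> 'g \<Rightarrow> 'g) \<Rightarrow> (('i, 'h) km_gen \<Rightarrow> 'g :: ab_group_add) \<Rightarrow>
     ('h \<Rightarrow> complex) \<Rightarrow> 'g env_gen alg_term set"
  for smul bracket gen \<Lambda> where
  verma_zero: "Zero \<in> verma_ideal smul bracket gen \<Lambda>"
| verma_cong: "s \<in> verma_ideal smul bracket gen \<Lambda> \<Longrightarrow> alg_cong (env_relation smul bracket) s t \<Longrightarrow>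
     t \<in> verma_ideal smul bracket gen \<Lambda>"
| verma_plus: "s \<in> verma_ideal smul bracket gen \<Lambda> \<Longrightarrow> t \<in> verma_ideal smul bracket gen \<Lambda> \<Longrightarrow>
     Plus s t \<in> verma_ideal smul bracket gen \<Lambda>"
| verma_times: "t \<in> verma_ideal smul bracket gen \<Lambda> \<Longrightarrow> Times s t \<in> verma_ideal smul bracket gen \<Lambda>"
| verma_n_plus: "x \<in> n_plus smul bracket gen \<Longrightarrow> Gen (Elem x) \<in> verma_ideal smul bracket gen \<Lambda>"
| verma_cartan: "Plus (Gen (Elem (gen (Gen_h h)))) (Scale (- \<Lambda> h) (Gen Unit))
     \<in> verma_ideal smul bracket gen \<Lambda>"

text \<open>
  The module on \<open>'m\<close> is (a copy of) \<open>M(\<Lambda>)\<close>, that is, of \<open>U(\<gg>) \<otimes> \<complex>\<^sub>\<Lambda>\<close> over \<open>U(\<bb>)\<close>, the quotient of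
  \<open>U(\<gg>)\<close> by the left ideal above.
\<close>

definition verma_module ::
    "(complex \<Rightarrow> 'g \<Rightarrow> 'g) \<Rightarrow> ('g \<Rightarrow> 'g \<Rightarrow> 'g) \<Rightarrow> (('i, 'h) km_gen \<Rightarrow> 'g :: ab_group_add) \<Rightarrow>
     ('h \<Rightarrow> complex) \<Rightarrow> (complex \<Rightarrow> 'm \<Rightarrow> 'm) \<Rightarrow> ('g \<Rightarrow> 'm \<Rightarrow> 'm :: ab_group_add) \<Rightarrow> bool" where
  "verma_module scale_g bracket gen \<Lambda> scale_M act \<longleftrightarrow>
     lie_module scale_g bracket scale_M act \<and>
     (\<exists>m. surj (\<lambda>u. env_act scale_M act u m) \<and>
          {u. env_act scale_M act u m = 0} = verma_ideal scale_g bracket gen \<Lambda>)"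

section \<open>The submodule \<open>N(\<Lambda>)\<close>\<close>

text \<open>
  The coefficient \<open>c i\<close> is determined by \<open>x\<close>, as the simple roots are linearly independent. Only
  \<open>x\<close> in their span matter: weights of \<open>M(\<Lambda>)\<close> differ from \<open>\<Lambda>\<close> by such \<open>x\<close>.
\<close>

definition root_supp :: "('i :: finite \<Rightarrow> 'h \<Rightarrow> complex) \<Rightarrow> ('h \<Rightarrow> complex) \<Rightarrow> 'i set" where
  "root_supp \<alpha> x = {i. \<exists>c. (\<forall>h. x h = (\<Sum>j\<in>UNIV. c j * \<alpha> j h)) \<and> c i \<noteq> 0}"

definition has_dynkin_edge :: "('i \<Rightarrow> 'h \<Rightarrow> complex) \<Rightarrow> ('i \<Rightarrow> 'h) \<Rightarrow> 'i set \<Rightarrow> bool" where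
  "has_dynkin_edge \<alpha> \<alpha>v S \<longleftrightarrow> (\<exists>i\<in>S. \<exists>j\<in>S. i \<noteq> j \<and> \<alpha> i (\<alpha>v j) \<noteq> 0)"

text \<open>
  The greatest submodule below exists: since \<open>wt (S + T) = wt S \<union> wt T\<close>, it is the sum of all
  submodules whose weights have the edge property.
\<close>

definition max_edge_submodule ::
    "(complex \<Rightarrow> 'h \<Rightarrow> 'h) \<Rightarrow> ('i :: finite \<Rightarrow> 'h \<Rightarrow> complex) \<Rightarrow> ('i \<Rightarrow> 'h :: ab_group_add) \<Rightarrow>
     (('i, 'h) km_gen \<Rightarrow> 'g) \<Rightarrow> ('h \<Rightarrow> complex) \<Rightarrow> (complex \<Rightarrow> 'm \<Rightarrow> 'm) \<Rightarrow>
     ('g \<Rightarrow> 'm \<Rightarrow> 'm) \<Rightarrow> 'm :: ab_group_add set" where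
  "max_edge_submodule scale_h \<alpha> \<alpha>v gen \<Lambda> smul act =
     (GREATEST N. lie_submodule smul act N \<and> N \<noteq> UNIV \<and>
        (\<forall>\<mu>\<in>weights scale_h gen smul act N.
           has_dynkin_edge \<alpha> \<alpha>v (root_supp \<alpha> (\<lambda>h. \<Lambda> h - \<mu> h))))"

end

theory Submission
  imports Defs "HOL-Library.Function_Algebras"
begin

text \<open>
  The weights of \<open>M(\<Lambda>)\<close> are exactly the \<open>\<Lambda> - \<Sum> c\<^sub>i \<alpha>\<^sub>i\<close> with natural \<open>c\<^sub>i\<close>. If the support of \<open>c\<close> is
  independent, then the \<open>f\<^sub>i\<close> in the support commute, by maximality of the ideal defining \<open>\<gg>(A)\<close>,
  so the weight space is a line; it is killed in \<open>V\<close> as soon as it meets \<open>N\<^sub>V\<close>. Conversely, for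
  every \<open>c\<close> the monomials can be ordered so that raising operators strip a suitable word in the
  \<open>f\<^sub>i\<close> down to its part with independent support, up to a nonzero factor; so if the word lies in
  \<open>N\<^sub>V\<close>, then so does a vector with independent support.

  That no word in the \<open>f\<^sub>i\<close> kills the highest weight vector of \<open>M(\<Lambda>)\<close> is shown on the module
  of words of the auxiliary algebra. The kernel of the map to \<open>\<gg>(A)\<close> is graded and has no
  component in degrees \<open>0\<close> and \<open>-1\<close>, so it acts on the vacuum through commutators, which vanish
  after abelianization, whereas words do not.
\<close>

section \<open>Eigenvector decompositions\<close>

text \<open>Nonvanishing of words in \<open>M(\<Lambda>)\<close> would follow from PBW and the
  absence of zero divisors in the enveloping algebra of \<open>n^-\<close>. Since only the set of
  weights matters, far less is proved: no word in the \<open>f i\<close> lies in the left ideal that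
  defines the Verma module. The obstacle is that \<open>g(A)\<close> is known only through a maximal
  ideal of the auxiliary algebra, without explicit relations. The words are a module over the
  auxiliary algebra, and a submodule must be divided out before \<open>g(A)\<close> acts. No
  quotient is formed: \<open>lift_act\<close> chooses preimages, and all identities are congruences
  modulo \<open>kernel_space\<close>. Maximality of the ideal enters where \<open>f i\<close> and
  \<open>f j\<close> must commute; its avoidance of the Cartan subalgebra makes \<open>H\<close>
  injective. The order of the letters in the word outside \<open>N_V\<close> depends on
  \<open>\<Lambda>\<close>, because the sl2 factor \<open>(k + 1)(s - k)\<close> vanishes at
  \<open>s = k\<close>; a neighbour with a large exponent pushes \<open>s\<close> past all dangerous
  \<open>k\<close>.\<close>

context vector_space
begin

text \<open>\<open>D k - ev n k\<close> annihilates the component \<open>n\<close> and multiplies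
  the component \<open>m\<close> by a nonzero number, so the other components can be removed one at
  a time. The operator that separates two components depends on the pair, hence a family
  \<open>D\<close>. With \<open>R = {0}\<close> this is the independence of eigenvectors.\<close>

lemma eigencomponents_in_subspace:
  assumes R: "subspace R" and DR: "\<And>k x. x \<in> R \<Longrightarrow> D k x \<in> R"
    and D: "\<And>k. Vector_Spaces.linear scale scale (D k)"
    and "finite S" and eig: "\<And>n k. n \<in> S \<Longrightarrow> D k (x n) = scale (ev n k) (x n)"
    and "\<And>n n'. n \<in> S \<Longrightarrow> n' \<in> S \<Longrightarrow> n \<noteq> n' \<Longrightarrow> \<exists>k. ev n k \<noteq> ev n' k"
    and "sum x S \<in> R" and "m \<in> S"
  shows "x m \<in> R"
  using assms(4-)
proof (induction "card S" arbitrary: S x m)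
  case 0
  then show ?case by simp
next
  case (Suc l)
  show ?case
  proof (cases "S = {m}")
    case True
    then show ?thesis using Suc by simp
  next
    case False
    then obtain n where n: "n \<in> S" "n \<noteq> m" using Suc by blast
    then obtain k where k: "ev n k \<noteq> ev m k" using Suc by blast
    define y where "y i = scale (ev i k - ev n k) (x i)" for i
    have "D k (sum x S) - scale (ev n k) (sum x S) \<in> R"
      using R DR Suc.prems(4) by (intro subspace_diff subspace_scale) auto
    also have "D k (sum x S) - scale (ev n k) (sum x S) = sum y S"
    proof -
      interpret L: Vector_Spaces.linear scale scale "D k" by (rule D)
      have "D k (sum x S) = (\<Sum>i\<in>S. scale (ev i k) (x i))"
        by (simp add: L.sum Suc.prems(2))
      then show ?thesis
        by (simp add: y_def scale_left_diff_distrib sum_subtractf scale_sum_right)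
    qed
    also have "sum y S = sum y (S - {n})"
      using Suc.prems(1) n(1) by (subst sum.remove[of S n]) (simp_all add: y_def)
    finally have yR: "sum y (S - {n}) \<in> R" .
    have "y m \<in> R"
    proof (rule Suc.hyps(1)[of "S - {n}"])
      show "l = card (S - {n})" using Suc.hyps(2) n(1) Suc.prems(1) by simp
      show "D k' (y i) = scale (ev i k') (y i)" if "i \<in> S - {n}" for i k'
      proof -
        interpret L: Vector_Spaces.linear scale scale "D k'" by (rule D)
        show ?thesis using that by (simp add: y_def L.scale Suc.prems(2) mult.commute)
      qed
    qed (use yR Suc.prems n in auto)
    then have "scale (inverse (ev m k - ev n k)) (y m) \<in> R" by (rule subspace_scale[OF R])
    then show ?thesis using k by (simp add: y_def)
  qed
qed

lemma span_UN_subspaces: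
  assumes "x \<in> span (\<Union>k. G k)" and G: "\<And>k. subspace (G k)"
  obtains S y where "finite S" and "\<And>k. y k \<in> G k" and "x = sum y S"
proof -
  have "\<exists>S y. finite S \<and> (\<forall>k. y k \<in> G k) \<and> x = sum y S"
    using assms(1)
  proof (induction rule: span_induct_alt)
    case base
    have "(\<forall>k. 0 \<in> G k) \<and> 0 = sum (\<lambda>_. 0) {}" using G subspace_0 by simp
    then show ?case by (metis finite.emptyI)
  next
    case (step c x y)
    then obtain S z k where z: "finite S" "\<And>k. z k \<in> G k" "y = sum z S" and k: "x \<in> G k" by auto
    define w where "w i = (if i \<in> S then z i else 0) + (if i = k then scale c x else 0)" for i
    have "sum w (insert k S) = sum (\<lambda>i. if i \<in> S then z i else 0) (insert k S) + scale c x"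
      using z(1) by (simp add: w_def sum.distrib)
    also have "sum (\<lambda>i. if i \<in> S then z i else 0) (insert k S) = sum z S"
      using z(1) by (simp add: sum.inter_restrict[symmetric] Int_absorb1 subset_insertI)
    finally have "scale c x + y = sum w (insert k S)" by (simp add: z(3))
    moreover have "\<forall>i. w i \<in> G i"
      using z(2) k G by (auto simp: w_def intro!: subspace_add subspace_scale subspace_0)
    ultimately show ?case using z(1) by (metis finite_insert)
  qed
  then show ?thesis using that by blast
qed

end

section \<open>Linear functionals\<close>

lemma linear_functional_iff:
  assumes "vector_space smul"
  shows "linear_functional smul \<mu> \<longleftrightarrow>
    (\<forall>x y. \<mu> (x + y) = \<mu> x + \<mu> y) \<and> (\<forall>a x. \<mu> (smul a x) = a * \<mu> x)"
proof -
  have "vector_space ((*) :: complex \<Rightarrow> _)" by unfold_locales (auto simp: algebra_simps)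
  with assms show ?thesis
    by (simp add: Vector_Spaces.linear_iff)
qed

lemma exists_linear_functional_nonzero:
  assumes "vector_space smul" and "h \<noteq> 0"
  obtains \<mu> where "linear_functional smul \<mu>" and "\<mu> h \<noteq> 0"
proof -
  have v: "vector_space ((*) :: complex \<Rightarrow> _)" by unfold_locales (auto simp: algebra_simps)
  interpret V: vector_space_pair smul "(*) :: complex \<Rightarrow> _"
    using assms(1) v by (simp add: vector_space_pair_def)
  have "\<not> V.vs1.dependent {h}" using assms(2) by simp
  from V.linear_independent_extend[OF this, of "\<lambda>_. 1"] that show thesis by force
qed

text \<open>Gram-Schmidt on the functionals: the family is enlarged by one functional at a time, and
  the vectors found earlier are corrected by multiples of the new one.\<close>

lemma linear_functionals_dual_family:
  fixes \<alpha> :: "'i :: finite \<Rightarrow> 'h :: ab_group_add \<Rightarrow> complex"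
  assumes vs: "vector_space smul" and lin: "\<And>i. linear_functional smul (\<alpha> i)"
    and ind: "\<And>c. \<forall>h. (\<Sum>i\<in>UNIV. c i * \<alpha> i h) = 0 \<Longrightarrow> \<forall>i. c i = 0"
  obtains d where "\<And>i j. \<alpha> j (d i) = (if i = j then 1 else 0)"
proof -
  interpret V: vector_space smul by fact
  have ad: "\<alpha> i (x + y) = \<alpha> i x + \<alpha> i y" and sc: "\<alpha> i (smul a x) = a * \<alpha> i x" for i x y a
    using lin linear_functional_iff[OF vs] by blast+
  have zr: "\<alpha> i 0 = 0" for i using ad[of i 0 0] by simp
  have neg: "\<alpha> i (- x) = - \<alpha> i x" for i x using ad[of i x "- x"] zr by (simp add: eq_neg_iff_add_eq_0 add.commute)
  have df: "\<alpha> i (x - y) = \<alpha> i x - \<alpha> i y" for i x y using ad[of i x "- y"] neg by simp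
  have sm: "\<alpha> i (sum g S) = (\<Sum>s\<in>S. \<alpha> i (g s))" if "finite S" for i S and g :: "'i \<Rightarrow> 'h"
    using that by induction (simp_all add: zr ad)
  have "finite S \<Longrightarrow> \<exists>d. \<forall>i\<in>S. \<forall>j\<in>S. \<alpha> j (d i) = (if i = j then 1 else 0)" for S :: "'i set"
  proof (induction rule: finite_induct)
    case empty
    then show ?case by simp
  next
    case (insert k S)
    then obtain d where d: "\<And>i j. i \<in> S \<Longrightarrow> j \<in> S \<Longrightarrow> \<alpha> j (d i) = (if i = j then 1 else 0)" by blast
    \<comment> \<open>Coefficients of \<open>\<alpha> k\<close> minus the combination of the earlier
      functionals that agrees with it on all \<open>d i\<close>. The value at \<open>h\<close> is
      \<open>\<alpha> k y\<close> for the \<open>y\<close> below, so independence supplies an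
      \<open>h\<close> with \<open>\<alpha> k y\<close> nonzero.\<close>
    define c where "c i = (if i = k then 1 else if i \<in> S then - \<alpha> k (d i) else 0)" for i
    have "\<not> (\<forall>i. c i = 0)" by (auto simp: c_def)
    then obtain h where h: "(\<Sum>i\<in>UNIV. c i * \<alpha> i h) \<noteq> 0" using ind by blast
    have "(\<Sum>i\<in>UNIV. c i * \<alpha> i h) = (\<Sum>i\<in>insert k S. c i * \<alpha> i h)"
      by (rule sum.mono_neutral_right) (auto simp: c_def)
    also have "\<dots> = \<alpha> k h + (\<Sum>i\<in>S. c i * \<alpha> i h)"
      using insert by (simp add: c_def)
    also have "(\<Sum>i\<in>S. c i * \<alpha> i h) = (\<Sum>i\<in>S. - (\<alpha> i h * \<alpha> k (d i)))"
      using insert by (intro sum.cong) (auto simp: c_def)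
    finally have h': "\<alpha> k h - (\<Sum>i\<in>S. \<alpha> i h * \<alpha> k (d i)) \<noteq> 0" using h by (simp add: sum_negf)
    define y where "y = h - (\<Sum>i\<in>S. smul (\<alpha> i h) (d i))"
    define z where "z = smul (inverse (\<alpha> k y)) y"
    have yk: "\<alpha> k y \<noteq> 0" using h' insert by (simp add: y_def df sm sc)
    then have zk: "\<alpha> k z = 1" by (simp add: z_def sc)
    have "\<alpha> j y = 0" if "j \<in> S" for j
    proof -
      have "(\<Sum>i\<in>S. \<alpha> i h * \<alpha> j (d i)) = (\<Sum>i\<in>S. if i = j then \<alpha> i h else 0)"
        using d that by (intro sum.cong) auto
      then show ?thesis using that insert by (simp add: y_def df sm sc)
    qed
    then have zj: "\<alpha> j z = 0" if "j \<in> S" for j using that by (simp add: z_def sc)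
    define d' where "d' i = (if i = k then z else d i - smul (\<alpha> k (d i)) z)" for i
    have "\<forall>i\<in>insert k S. \<forall>j\<in>insert k S. \<alpha> j (d' i) = (if i = j then 1 else 0)"
      using insert zk zj d by (auto simp: d'_def df sc)
    then show ?case by blast
  qed
  from this[of UNIV] that show thesis by auto
qed

section \<open>Lie algebras with Chevalley generators\<close>

context lie_algebra
begin

lemma bracket_zero [simp]: "bracket 0 x = 0" "bracket x 0 = 0"
  using bracket_add_left[of 0 0 x] bracket_add_right[of x 0 0] by simp_all

lemma bracket_antisym: "bracket x y = - bracket y x"
proof -
  have "bracket (x + y) (x + y) = bracket x x + bracket y x + (bracket x y + bracket y y)"
    by (simp only: bracket_add_left bracket_add_right)
  then show ?thesis by (simp add: bracket_self eq_neg_iff_add_eq_0 add.commute)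
qed

lemma bracket_minus [simp]: "bracket (- x) y = - bracket x y" "bracket x (- y) = - bracket x y"
  using bracket_add_left[of x "- x" y] bracket_add_right[of x y "- y"]
  by (simp_all add: eq_neg_iff_add_eq_0 add.commute)

lemma bracket_derivation: "bracket x (bracket y z) = bracket (bracket x y) z + bracket y (bracket x z)"
proof -
  have "bracket y (bracket z x) = - bracket y (bracket x z)"
    by (simp add: bracket_antisym[of z x])
  moreover have "bracket z (bracket x y) = - bracket (bracket x y) z" by (rule bracket_antisym)
  ultimately have "bracket x (bracket y z) - bracket y (bracket x z) - bracket (bracket x y) z = 0"
    using jacobi[of x y z] by simp
  then show ?thesis by (simp add: algebra_simps)
qed

lemma linear_bracket: "Vector_Spaces.linear smul smul (bracket x)"
  by (simp add: Vector_Spaces.linear_iff bracket_add_right bracket_scale_right vector_space_axioms)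

lemma bracket_in_span:
  assumes "y \<in> span S" and "\<And>s. s \<in> S \<Longrightarrow> bracket x s \<in> span S"
  shows "bracket x y \<in> span S"
  using assms(1)
  by (induction rule: span_induct_alt)
    (auto simp: bracket_add_right bracket_scale_right intro: span_zero span_add span_scale assms(2))

lemma ad_eval_stable:
  assumes "subspace S" and "\<And>g x. x \<in> S \<Longrightarrow> bracket (gen g) x \<in> S" and "x \<in> S"
  shows "bracket (alg_eval smul bracket gen t) x \<in> S"
  using assms(3)
proof (induction t arbitrary: x)
  case (Times s t)
  have "bracket (bracket a b) x = bracket a (bracket b x) - bracket b (bracket a x)" for a b
    using bracket_derivation[of a b x] by simp
  then show ?case using Times assms(1) by (simp add: subspace_diff)
qed (use assms in \<open>auto simp: bracket_add_left bracket_scale_left subspace_0 subspace_add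
      subspace_scale\<close>)

text \<open>Degree \<open>d\<close> part of the subalgebra generated by the family \<open>x\<close> in degree one.\<close>

inductive homogeneous :: "('i \<Rightarrow> 'g) \<Rightarrow> nat \<Rightarrow> 'g \<Rightarrow> bool" for x where
  homogeneous_gen: "homogeneous x 1 (x i)"
| homogeneous_bracket: "homogeneous x d y \<Longrightarrow> homogeneous x (Suc d) (bracket (x i) y)"
| homogeneous_zero: "homogeneous x d 0"
| homogeneous_add: "homogeneous x d y \<Longrightarrow> homogeneous x d z \<Longrightarrow> homogeneous x d (y + z)"
| homogeneous_scale: "homogeneous x d y \<Longrightarrow> homogeneous x d (smul a y)"

lemma subspace_homogeneous: "subspace {y. homogeneous x d y}"
  by (auto simp: subspace_def intro: homogeneous.intros)

text \<open>Degree zero is trivial because generation starts in degree one; so the bracket rule at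
  \<open>d = 0\<close> adds nothing to degree one.\<close>

lemma homogeneous_0: "homogeneous x d y \<Longrightarrow> d = 0 \<Longrightarrow> y = 0"
  by (induction rule: homogeneous.induct) auto

lemma homogeneous_1:
  fixes x :: "'i :: finite \<Rightarrow> 'g"
  assumes "homogeneous x d y" and "d = 1"
  shows "\<exists>c. y = (\<Sum>i\<in>UNIV. smul (c i) (x i))"
  using assms
proof (induction rule: homogeneous.induct)
  case (homogeneous_gen i)
  have "(\<Sum>j\<in>UNIV. smul (if j = i then 1 else 0) (x j)) = (\<Sum>j\<in>UNIV. if j = i then x j else 0)"
    by (intro sum.cong) auto
  then show ?case by (intro exI[of _ "\<lambda>j. if j = i then 1 else 0"]) simp
next
  case (homogeneous_bracket d y i)
  then have "y = 0" by (simp add: homogeneous_0)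
  then show ?case by (intro exI[of _ "\<lambda>_. 0"]) simp
next
  case (homogeneous_zero d)
  show ?case by (intro exI[of _ "\<lambda>_. 0"]) simp
next
  case (homogeneous_add d y z)
  then obtain c c' where "y = (\<Sum>i\<in>UNIV. smul (c i) (x i))" "z = (\<Sum>i\<in>UNIV. smul (c' i) (x i))"
    by auto
  then show ?case
    by (intro exI[of _ "\<lambda>i. c i + c' i"]) (simp add: scale_left_distrib sum.distrib)
next
  case (homogeneous_scale d y a)
  then obtain c where "y = (\<Sum>i\<in>UNIV. smul (c i) (x i))" by auto
  then show ?case by (intro exI[of _ "\<lambda>i. a * c i"]) (simp add: scale_sum_right)
qed

lemma homogeneous_stable:
  assumes z: "\<And>i. bracket z (x i) = smul (c i) (x i)" and "homogeneous x d y"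
  shows "homogeneous x d (bracket z y)"
  using assms(2)
proof (induction rule: homogeneous.induct)
  case (homogeneous_gen i)
  then show ?case by (simp only: z homogeneous.intros)
next
  case (homogeneous_bracket d y i)
  then show ?case
    by (subst bracket_derivation) (auto simp: z bracket_scale_left intro!: homogeneous.intros)
qed (auto simp: bracket_add_right bracket_scale_right intro: homogeneous.intros)

lemma homogeneous_eigenvector:
  assumes z: "\<And>i. bracket z (x i) = smul c (x i)" and "homogeneous x d y"
  shows "bracket z y = smul (of_nat d * c) y"
  using assms(2)
proof (induction rule: homogeneous.induct)
  case (homogeneous_bracket d y i)
  have "bracket z (bracket (x i) y) = bracket (smul c (x i)) y + bracket (x i) (smul (of_nat d * c) y)"
    by (subst bracket_derivation) (simp add: z homogeneous_bracket)
  then show ?case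
    by (simp add: bracket_scale_left bracket_scale_right distrib_right scale_left_distrib)
qed (use z in \<open>simp_all add: bracket_add_right bracket_scale_right scale_right_distrib mult.commute\<close>)

end

text \<open>Only the relations of the auxiliary algebra are imposed, so the results apply to
  \<open>g(A)\<close>, to the operators on words and to the product of the two.\<close>

locale chevalley = lie_algebra smul bracket
  for smul :: "complex \<Rightarrow> 'g :: ab_group_add \<Rightarrow> 'g" and bracket +
  fixes scale_h :: "complex \<Rightarrow> 'h :: ab_group_add \<Rightarrow> 'h"
    and \<alpha> :: "'i :: finite \<Rightarrow> 'h \<Rightarrow> complex" and \<alpha>v :: "'i \<Rightarrow> 'h"
    and gen :: "('i, 'h) km_gen \<Rightarrow> 'g"
  assumes h_add: "gen (Gen_h (x + y)) = gen (Gen_h x) + gen (Gen_h y)"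
    and h_scale: "gen (Gen_h (scale_h a x)) = smul a (gen (Gen_h x))"
    and e_f: "bracket (gen (Gen_e i)) (gen (Gen_f j)) = (if i = j then gen (Gen_h (\<alpha>v i)) else 0)"
    and h_h: "bracket (gen (Gen_h x)) (gen (Gen_h y)) = 0"
    and h_e: "bracket (gen (Gen_h x)) (gen (Gen_e i)) = smul (\<alpha> i x) (gen (Gen_e i))"
    and h_f: "bracket (gen (Gen_h x)) (gen (Gen_f i)) = smul (- \<alpha> i x) (gen (Gen_f i))"
begin

abbreviation "e i \<equiv> gen (Gen_e i)"
abbreviation "f i \<equiv> gen (Gen_f i)"
abbreviation "H x \<equiv> gen (Gen_h x)"
abbreviation "eval \<equiv> alg_eval smul bracket gen"

lemma eval_alg_cong:
  assumes "alg_cong (lie_relation (km_relation scale_h \<alpha> \<alpha>v)) s t"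
  shows "eval s = eval t"
  using assms
proof (induction rule: alg_cong.induct)
  case (ac_rel s t)
  then show ?case
  proof (cases rule: lie_relation.cases)
    case lr_rel
    then show ?thesis
      by cases (simp_all add: h_add h_scale e_f h_h h_e h_f)
  qed (simp_all add: bracket_self jacobi[unfolded add.assoc])
qed (simp_all add: bracket_add_left bracket_add_right bracket_scale_left bracket_scale_right
    scale_left_distrib scale_right_distrib ac_simps)

lemma h_zero: "H 0 = 0"
  using h_add[of 0 0] by simp

lemma h_minus: "H (- x) = - H x"
  using h_add[of x "- x"] h_zero by (simp add: eq_neg_iff_add_eq_0 add.commute)

lemma subspace_range_h: "subspace (range H)"
proof -
  have "0 \<in> range H" using h_zero by (metis rangeI)
  then show ?thesis by (auto simp: subspace_def h_add[symmetric] h_scale[symmetric])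
qed

text \<open>The image of the generators under the Chevalley involution.\<close>

definition opposite :: "('i, 'h) km_gen \<Rightarrow> 'g" where
  "opposite g = (case g of Gen_e i \<Rightarrow> f i | Gen_f i \<Rightarrow> e i | Gen_h x \<Rightarrow> H (- x))"

lemma chevalley_opposite: "chevalley smul bracket scale_h \<alpha> \<alpha>v opposite"
proof
  fix i j :: 'i and x y a
  show "opposite (Gen_h (x + y)) = opposite (Gen_h x) + opposite (Gen_h y)"
    by (simp add: opposite_def h_add[symmetric] del: add_uminus_conv_diff)
  show "opposite (Gen_h (scale_h a x)) = smul a (opposite (Gen_h x))"
    by (simp add: opposite_def h_minus h_scale)
  show "bracket (opposite (Gen_e i)) (opposite (Gen_f j)) = (if i = j then opposite (Gen_h (\<alpha>v i)) else 0)"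
    by (simp add: opposite_def h_minus bracket_antisym[of "f i" "e j"] e_f)
  show "bracket (opposite (Gen_h x)) (opposite (Gen_h y)) = 0"
    by (simp add: opposite_def h_minus h_h)
  show "bracket (opposite (Gen_h x)) (opposite (Gen_e i)) = smul (\<alpha> i x) (opposite (Gen_e i))"
    by (simp add: opposite_def h_minus h_f)
  show "bracket (opposite (Gen_h x)) (opposite (Gen_f i)) = smul (- \<alpha> i x) (opposite (Gen_f i))"
    by (simp add: opposite_def h_minus h_e)
qed

text \<open>Jacobi splits \<open>[e i, [f j, y]]\<close> into \<open>[[e i, f j], y]\<close> and
  \<open>[f j, [e i, y]]\<close>. Degree one is singled out because there \<open>e i\<close> leads
  into the Cartan subalgebra.\<close>

lemma e_homogeneous_f:
  assumes "homogeneous f d y"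
  shows "if d \<le> 1 then bracket (e i) y \<in> range H else homogeneous f (d - 1) (bracket (e i) y)"
  using assms
proof (induction rule: homogeneous.induct)
  case (homogeneous_gen j)
  then show ?case using subspace_range_h by (auto simp: e_f dest: subspace_0)
next
  case (homogeneous_bracket d y j)
  have h: "homogeneous f d (bracket (H x) y)" for x
    by (rule homogeneous_stable[OF h_f]) fact
  have "homogeneous f d (bracket (bracket (e i) (f j)) y)"
    by (auto simp: e_f h intro: homogeneous.intros)
  moreover have "homogeneous f d (bracket (f j) (bracket (e i) y))" if "d \<ge> 1"
  proof (cases "d = 1")
    \<comment> \<open>The inner bracket is some \<open>H x\<close>, and \<open>[f j, H x]\<close> is
      a multiple of \<open>f j\<close>, so degree one is regained.\<close>
    case True
    then obtain x where "bracket (e i) y = H x" using homogeneous_bracket.IH by auto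
    then have "bracket (f j) (bracket (e i) y) = smul (\<alpha> j x) (f j)"
      using bracket_antisym[of "f j" "H x"] by (simp add: h_f)
    then show ?thesis using True homogeneous_scale[OF homogeneous_gen[of f j]] by simp
  next
    case False
    then show ?thesis using homogeneous_bracket.IH that
      homogeneous.homogeneous_bracket[of f "d - 1" "bracket (e i) y" j] by simp
  qed
  ultimately have "homogeneous f d (bracket (e i) (bracket (f j) y))" if "d \<ge> 1"
    using that by (subst bracket_derivation) (auto intro: homogeneous.intros)
  moreover have "y = 0" if "d = 0" using homogeneous_bracket.hyps homogeneous_0 that by blast
  ultimately show ?case using subspace_0[OF subspace_range_h] by (cases "d = 0") auto
next
  case (homogeneous_zero d)
  then show ?case using subspace_0[OF subspace_range_h] by (auto intro: homogeneous.intros)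
next
  case (homogeneous_add d y z)
  then show ?case using subspace_add[OF subspace_range_h]
    by (auto simp: bracket_add_right intro: homogeneous.intros split: if_splits)
next
  case (homogeneous_scale d y a)
  then show ?case using subspace_scale[OF subspace_range_h]
    by (auto simp: bracket_scale_right intro: homogeneous.intros split: if_splits)
qed

lemma f_homogeneous_e:
  assumes "homogeneous e d y"
  shows "if d \<le> 1 then bracket (f i) y \<in> range H else homogeneous e (d - 1) (bracket (f i) y)"
proof -
  interpret O: chevalley smul bracket scale_h \<alpha> \<alpha>v opposite by (rule chevalley_opposite)
  have "range (\<lambda>x. H (- x)) = range H"
    using image_image[of H uminus UNIV] surj_uminus by metis
  then show ?thesis using O.e_homogeneous_f[of d y i] assms
    by (simp add: opposite_def split: if_splits)
qed

section \<open>The principal grading\<close>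

definition piece :: "int \<Rightarrow> 'g set" where
  "piece d = (if d < 0 then {y. homogeneous f (nat (- d)) y}
              else if d = 0 then range H else {y. homogeneous e (nat d) y})"

lemma subspace_piece: "subspace (piece d)"
  by (simp add: piece_def subspace_homogeneous subspace_range_h)

lemma bracket_gen_piece:
  assumes "y \<in> piece d"
  shows "\<exists>d'. bracket (gen g) y \<in> piece d'"
proof (cases g)
  case (Gen_e i)
  consider "d < -1" | "d = -1" | "d = 0" | "d > 0" by linarith
  then have "bracket (e i) y \<in> piece (d + 1)"
  proof cases
    case 1
    moreover have "nat (- d) - 1 = nat (- d - 1)" by simp
    ultimately show ?thesis using assms e_homogeneous_f[of "nat (- d)" y i]
      by (auto simp: piece_def split: if_splits)
  next
    case 2
    then show ?thesis using assms e_homogeneous_f[of "nat (- d)" y i]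
      by (auto simp: piece_def split: if_splits)
  next
    case 3
    then obtain x where "y = H x" using assms by (auto simp: piece_def)
    then have y: "bracket (e i) y = smul (- \<alpha> i x) (e i)"
      using bracket_antisym[of "e i" "H x"] h_e by simp
    show ?thesis unfolding y using 3 homogeneous_scale[OF homogeneous_gen[of e i], of "- \<alpha> i x"]
      by (simp add: piece_def)
  next
    case 4
    then show ?thesis using assms homogeneous_bracket[of e "nat d" y i]
      by (simp add: piece_def nat_add_distrib)
  qed
  then show ?thesis using Gen_e by blast
next
  case (Gen_f i)
  consider "d > 1" | "d = 1" | "d = 0" | "d < 0" by linarith
  then have "bracket (f i) y \<in> piece (d - 1)"
  proof cases
    case 1
    moreover have "nat d - 1 = nat (d - 1)" by simp
    ultimately show ?thesis using assms f_homogeneous_e[of "nat d" y i]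
      by (auto simp: piece_def split: if_splits)
  next
    case 2
    then show ?thesis using assms f_homogeneous_e[of "nat d" y i]
      by (auto simp: piece_def split: if_splits)
  next
    case 3
    then obtain x where "y = H x" using assms by (auto simp: piece_def)
    then have y: "bracket (f i) y = smul (\<alpha> i x) (f i)"
      using bracket_antisym[of "f i" "H x"] h_f by simp
    show ?thesis unfolding y using 3 homogeneous_scale[OF homogeneous_gen[of f i], of "\<alpha> i x"]
      by (simp add: piece_def)
  next
    case 4
    moreover have "nat (1 - d) = Suc (nat (- d))" using 4 by simp
    ultimately show ?thesis using assms homogeneous_bracket[of f "nat (- d)" y i]
      by (simp add: piece_def)
  qed
  then show ?thesis using Gen_f by blast
next
  case (Gen_h x)
  have "bracket (H x) y \<in> piece d"
    using assms homogeneous_stable[OF h_f] homogeneous_stable[OF h_e] subspace_0[OF subspace_range_h]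
    by (auto simp: piece_def h_h split: if_splits)
  then show ?thesis using Gen_h by blast
qed

text \<open>The triangular decomposition. The span is stable under \<open>ad\<close> of the
  generators, hence under \<open>ad\<close> of every \<open>eval s\<close>, which settles brackets.
  Directness of the sum comes separately from eigenvalues of a grading element.\<close>

lemma eval_in_span_pieces: "eval t \<in> span (\<Union>d. piece d)"
proof (induction t)
  case (Gen g)
  have "\<exists>d. gen g \<in> piece d"
  proof (cases g)
    case (Gen_e i)
    then show ?thesis using homogeneous_gen[of e i] by (intro exI[of _ 1]) (simp add: piece_def)
  next
    case (Gen_f i)
    then show ?thesis using homogeneous_gen[of f i] by (intro exI[of _ "-1"]) (simp add: piece_def)
  next
    case (Gen_h x)
    then show ?thesis by (intro exI[of _ 0]) (simp add: piece_def)
  qed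
  then show ?case by (auto intro: span_base)
next
  case (Times s t)
  have "bracket (gen g) x \<in> span (\<Union>d. piece d)" if "x \<in> span (\<Union>d. piece d)" for g x
    using that by (rule bracket_in_span) (use bracket_gen_piece in \<open>auto intro!: span_base\<close>)
  from ad_eval_stable[OF subspace_span this Times(2)] show ?case by simp
qed (auto intro: span_zero span_add span_scale)

lemma piece_eigenvector:
  assumes "\<And>i. \<alpha> i x = 1" and "y \<in> piece d"
  shows "bracket (H x) y = smul (of_int d) y"
proof -
  have "bracket (H x) (f i) = smul (-1) (f i)" "bracket (H x) (e i) = smul 1 (e i)" for i
    by (simp_all add: h_f h_e assms(1))
  from homogeneous_eigenvector[of "H x" f, OF this(1)] homogeneous_eigenvector[of "H x" e, OF this(2)]
  show ?thesis using assms(2) by (auto simp: piece_def h_h split: if_splits)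
qed

end

text \<open>The relations hold in the algebra because the kernel is closed under the congruence:
  \<open>t - t\<close> lies in it, hence so does the congruent \<open>s - t\<close>.\<close>

lemma kac_moody_algebra_chevalley:
  fixes \<alpha> :: "'i :: finite \<Rightarrow> 'h :: ab_group_add \<Rightarrow> complex"
  assumes "kac_moody_algebra scale_h \<alpha> \<alpha>v scale_g bracket gen"
  shows "chevalley scale_g bracket scale_h \<alpha> \<alpha>v gen"
proof -
  interpret lie_algebra scale_g bracket using assms by (simp add: kac_moody_algebra_def)
  let ?eval = "alg_eval scale_g bracket gen"
  have ker: "presented_lie_ideal (km_relation scale_h \<alpha> \<alpha>v) {t. ?eval t = 0}"
    using assms by (simp add: kac_moody_algebra_def cartan_avoiding_ideal_def Let_def)
  have *: "?eval s = ?eval t" if "km_relation scale_h \<alpha> \<alpha>v s t" for s t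
  proof -
    have "alg_cong (lie_relation (km_relation scale_h \<alpha> \<alpha>v)) (Plus t (Scale (-1) t)) (Plus s (Scale (-1) t))"
      using that by (intro ac_cong_Plus ac_refl ac_sym[OF ac_rel] lr_rel)
    moreover have "?eval (Plus t (Scale (-1) t)) = 0" by simp
    ultimately have "?eval (Plus s (Scale (-1) t)) = 0"
      using ker unfolding presented_lie_ideal_def by blast
    then show ?thesis by simp
  qed
  show ?thesis
  proof
    fix i j :: 'i
    show "bracket (gen (Gen_e i)) (gen (Gen_f j)) = (if i = j then gen (Gen_h (\<alpha>v i)) else 0)"
      using *[OF km_e_f_same] *[OF km_e_f_diff] by auto
  qed (simp_all add: *[OF km_h_add, simplified] *[OF km_h_scale, simplified]
      *[OF km_h_h, simplified] *[OF km_h_e, simplified] *[OF km_h_f, simplified])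
qed

section \<open>Highest weight modules\<close>

text \<open>Take a vertex \<open>k\<close> with the largest \<open>c\<close>, discard its neighbours
  and repeat; whatever is discarded is adjacent to a chosen vertex of at least the same
  \<open>c\<close>.\<close>

lemma greedy_independent_subset:
  fixes c :: "'a \<Rightarrow> nat"
  assumes "finite S"
  shows "\<exists>J \<subseteq> S. (\<forall>i\<in>J. \<forall>j\<in>J. i \<noteq> j \<longrightarrow> \<not> E i j \<and> \<not> E j i) \<and>
    (\<forall>i\<in>S - J. \<exists>j\<in>J. (E i j \<or> E j i) \<and> c i \<le> c j)"
  using assms
proof (induction S rule: finite_psubset_induct)
  case (psubset S)
  show ?case
  proof (cases "S = {}")
    case False
    then have "Max (c ` S) \<in> c ` S" using psubset.hyps by simp
    then obtain k where k': "k \<in> S" "Max (c ` S) = c k" by auto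
    have k: "c i \<le> c k" if "i \<in> S" for i
      using that psubset.hyps by (simp flip: k'(2))
    define T where "T = {i \<in> S. i \<noteq> k \<and> \<not> E i k \<and> \<not> E k i}"
    have "T \<subset> S" using k' by (auto simp: T_def)
    from psubset.IH[OF this] obtain J where J: "J \<subseteq> T" "\<forall>i\<in>J. \<forall>j\<in>J. i \<noteq> j \<longrightarrow> \<not> E i j \<and> \<not> E j i"
      "\<forall>i\<in>T - J. \<exists>j\<in>J. (E i j \<or> E j i) \<and> c i \<le> c j"
      by (elim exE conjE) (rule that)
    show ?thesis
    proof (intro exI[of _ "insert k J"] conjI ballI impI)
      show "insert k J \<subseteq> S" using J(1) k' by (auto simp: T_def)
    next
      fix i j assume "i \<in> insert k J" "j \<in> insert k J" "i \<noteq> j"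
      then show "\<not> E i j" "\<not> E j i" using J(1,2) by (auto simp: T_def)
    next
      fix i assume i: "i \<in> S - insert k J"
      show "\<exists>j\<in>insert k J. (E i j \<or> E j i) \<and> c i \<le> c j"
      proof (cases "i \<in> T")
        case True
        then have "\<exists>j\<in>J. (E i j \<or> E j i) \<and> c i \<le> c j" using J(3) i by simp
        then show ?thesis by (rule bexE) (rule bexI[rotated], rule insertI2, assumption+)
      next
        case False
        then have "E i k \<or> E k i" using i by (simp add: T_def)
        then show ?thesis using i k by simp
      qed
    qed
  qed auto
qed

section \<open>Words in the simple roots, their weights and exponents\<close>

definition word_weight :: "('i \<Rightarrow> 'h \<Rightarrow> complex) \<Rightarrow> 'i list \<Rightarrow> 'h \<Rightarrow> complex" where
  "word_weight \<alpha> w h = (\<Sum>i\<leftarrow>w. \<alpha> i h)"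

lemma word_weight_simps [simp]:
  "word_weight \<alpha> [] h = 0"
  "word_weight \<alpha> (i # w) h = \<alpha> i h + word_weight \<alpha> w h"
  "word_weight \<alpha> (u @ w) h = word_weight \<alpha> u h + word_weight \<alpha> w h"
  by (simp_all add: word_weight_def)

lemma word_weight_replicate [simp]: "word_weight \<alpha> (replicate k i) h = of_nat k * \<alpha> i h"
  by (induction k) (simp_all add: algebra_simps)

lemma word_weight_count_list:
  fixes \<alpha> :: "'i :: finite \<Rightarrow> 'h \<Rightarrow> complex"
  shows "word_weight \<alpha> w h = (\<Sum>i\<in>UNIV. of_nat (count_list w i) * \<alpha> i h)"
proof (induction w)
  case (Cons j w)
  have "(\<Sum>i\<in>UNIV. of_nat (count_list (j # w) i) * \<alpha> i h) =
    (\<Sum>i\<in>UNIV. (if i = j then \<alpha> i h else 0) + of_nat (count_list w i) * \<alpha> i h)"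
    by (intro sum.cong) (auto simp: algebra_simps)
  then show ?case by (simp add: Cons sum.distrib)
qed simp

definition blocks :: "('i \<Rightarrow> nat) \<Rightarrow> 'i list \<Rightarrow> 'i list" where
  "blocks c l = concat (map (\<lambda>i. replicate (c i) i) l)"

lemma blocks_simps [simp]: "blocks c [] = []" "blocks c (i # l) = replicate (c i) i @ blocks c l"
  "blocks c (l @ l') = blocks c l @ blocks c l'"
  by (simp_all add: blocks_def)

lemma set_blocks: "set (blocks c l) = {i \<in> set l. c i > 0}"
  by (auto simp: blocks_def)

lemma count_list_replicate: "count_list (replicate k i) j = (if i = j then k else 0)"
  by (induction k) auto

lemma count_list_blocks: "distinct l \<Longrightarrow> count_list (blocks c l) i = (if i \<in> set l then c i else 0)"
  by (induction l) (auto simp: count_list_replicate)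

section \<open>Modules over an algebra with Chevalley generators\<close>

locale chevalley_module = chevalley smul bracket scale_h \<alpha> \<alpha>v gen + lie_module smul bracket scale_M act
  for smul :: "complex \<Rightarrow> 'g :: ab_group_add \<Rightarrow> 'g" and bracket
    and scale_h :: "complex \<Rightarrow> 'h :: ab_group_add \<Rightarrow> 'h"
    and \<alpha> :: "'i :: finite \<Rightarrow> 'h \<Rightarrow> complex" and \<alpha>v :: "'i \<Rightarrow> 'h"
    and gen :: "('i, 'h) km_gen \<Rightarrow> 'g"
    and scale_M :: "complex \<Rightarrow> 'm :: ab_group_add \<Rightarrow> 'm" and act
begin

definition word_act :: "'i list \<Rightarrow> 'm \<Rightarrow> 'm" where
  "word_act w x = foldr (\<lambda>i. act (f i)) w x"

definition weight_vector :: "('h \<Rightarrow> complex) \<Rightarrow> 'm \<Rightarrow> bool" where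
  "weight_vector \<mu> x \<longleftrightarrow> (\<forall>h. act (H h) x = scale_M (\<mu> h) x)"

lemma linear_act: "Vector_Spaces.linear scale_M scale_M (act x)"
  by (simp add: Vector_Spaces.linear_iff act_add_right act_scale_right M.vector_space_axioms)

lemma act_zero [simp]: "act 0 v = 0" "act x 0 = 0"
  using act_add_left[of 0 0 v] act_add_right[of x 0 0] by simp_all

lemma act_minus [simp]: "act (- x) v = - act x v" "act x (- v) = - act x v"
  using act_add_left[of x "- x" v] act_add_right[of x v "- v"]
  by (simp_all add: eq_neg_iff_add_eq_0 add.commute)

lemma act_diff_right: "act x (v - w) = act x v - act x w"
  using act_add_right[of x v "- w"] by simp

lemma act_in_span:
  assumes "v \<in> M.span S" and "\<And>s. s \<in> S \<Longrightarrow> act x s \<in> M.span S'"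
  shows "act x v \<in> M.span S'"
  using assms(1)
  by (induction rule: M.span_induct_alt)
    (auto simp: act_add_right act_scale_right intro: M.span_zero M.span_add M.span_scale assms(2))

lemma act_eval_stable:
  assumes X: "M.subspace X" and "\<And>g x. x \<in> X \<Longrightarrow> act (gen g) x \<in> X" and "x \<in> X"
  shows "act (eval t) x \<in> X"
  using assms(3)
proof (induction t arbitrary: x)
  case Zero
  then show ?case by (simp add: M.subspace_0[OF X])
next
  case (Times s t)
  then show ?case by (simp add: act_bracket M.subspace_diff[OF X])
qed (use assms(2) in \<open>auto simp: act_add_left act_scale_left intro: M.subspace_add[OF X]
      M.subspace_scale[OF X]\<close>)

lemma word_act_simps [simp]:
  "word_act [] x = x" "word_act (i # w) x = act (f i) (word_act w x)"
  "word_act (u @ w) x = word_act u (word_act w x)"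
  by (simp_all add: word_act_def)

lemma word_act_add: "word_act w (x + y) = word_act w x + word_act w y"
  by (induction w) (simp_all add: act_add_right)

lemma word_act_scale: "word_act w (scale_M a x) = scale_M a (word_act w x)"
  by (induction w) (simp_all add: act_scale_right)

lemma word_act_zero [simp]: "word_act w 0 = 0"
  by (induction w) simp_all

lemma e_act_f: "act (e i) (act (f j) x) =
    act (f j) (act (e i) x) + (if i = j then act (H (\<alpha>v i)) x else 0)"
  using act_bracket[of "e i" "f j" x] by (auto simp: e_f)

lemma h_act_f: "act (H h) (act (f j) x) = act (f j) (act (H h) x) - scale_M (\<alpha> j h) (act (f j) x)"
  using act_bracket[of "H h" "f j" x] by (simp add: h_f act_scale_left algebra_simps)

lemma h_act_word: "act (H h) (word_act w x) =
    word_act w (act (H h) x) - scale_M (word_weight \<alpha> w h) (word_act w x)"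
  by (induction w) (simp_all add: h_act_f act_scale_right act_diff_right
      M.scale_left_distrib)

lemma weight_vector_word_act:
  "weight_vector \<mu> x \<Longrightarrow> weight_vector (\<lambda>h. \<mu> h - word_weight \<alpha> w h) (word_act w x)"
  by (simp add: weight_vector_def h_act_word word_act_scale M.scale_left_diff_distrib)

text \<open>The submodule generated by \<open>S\<close> under the subalgebra of the
  \<open>f i\<close>, that is, \<open>U(n^-) S\<close>.\<close>

definition words_span :: "'m set \<Rightarrow> 'm set" where
  "words_span S = M.span (\<Union>w. word_act w ` S)"

lemma word_act_words_span:
  assumes "x \<in> M.span S"
  shows "word_act w x \<in> words_span S"
  using assms
proof (induction rule: M.span_induct_alt)
  case base
  then show ?case by (simp add: words_span_def M.span_zero)
next
  case (step c x y)
  have "word_act w x \<in> words_span S"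
    unfolding words_span_def using step.hyps by (intro M.span_base) blast
  then show ?case using step.IH unfolding words_span_def
    by (simp add: word_act_add word_act_scale M.span_add M.span_scale)
qed

text \<open>The easy half of PBW: moving \<open>e i\<close> or \<open>H h\<close> rightwards through
  a word leaves only words applied to the span of \<open>S\<close>. It serves the highest weight
  vector, the vacuum, the kernel vectors and, in an adjoint module, a commutator of two
  \<open>f i\<close>.\<close>

lemma words_span_stable:
  assumes H: "\<And>h s. s \<in> S \<Longrightarrow> act (H h) s \<in> M.span S"
    and E: "\<And>i s. s \<in> S \<Longrightarrow> act (e i) s \<in> M.span S"
    and x: "x \<in> words_span S"
  shows "act (eval t) x \<in> words_span S"
proof (rule act_eval_stable[OF _ _ x])
  show ws: "M.subspace (words_span S)" by (simp add: words_span_def)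
  have Hw: "act (H h) (word_act w s) \<in> words_span S" if "s \<in> S" for h w s
    unfolding h_act_word
    by (intro M.subspace_diff[OF ws] M.subspace_scale[OF ws] word_act_words_span H M.span_base that)
  have Fw: "act (f i) x \<in> words_span S" if "x \<in> words_span S" for i x
    using that unfolding words_span_def
  proof (rule act_in_span)
    fix y assume "y \<in> (\<Union>w. word_act w ` S)"
    then obtain w s where "s \<in> S" "y = word_act w s" by blast
    then have "act (f i) y = word_act (i # w) s" by simp
    then show "act (f i) y \<in> M.span (\<Union>w. word_act w ` S)"
      using \<open>s \<in> S\<close> by (blast intro: M.span_base)
  qed
  have Ew: "act (e i) (word_act w s) \<in> words_span S" if s: "s \<in> S" for i w s
  proof (induction w)
    case Nil
    then show ?case using word_act_words_span[OF E[OF s], of "[]"] by simp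
  next
    case (Cons j w)
    have "(if i = j then act (H (\<alpha>v i)) (word_act w s) else 0) \<in> words_span S"
      using Hw[OF s] M.subspace_0[OF ws] by simp
    from M.subspace_add[OF ws Fw[OF Cons, of j] this] show ?case by (simp add: e_act_f)
  qed
  fix g x assume "x \<in> words_span S"
  then show "act (gen g) x \<in> words_span S"
  proof (cases g)
    case (Gen_e i)
    show ?thesis unfolding Gen_e words_span_def
      by (rule act_in_span[OF \<open>x \<in> words_span S\<close>[unfolded words_span_def]])
        (use Ew in \<open>auto simp: words_span_def\<close>)
  next
    case (Gen_h h)
    show ?thesis unfolding Gen_h words_span_def
      by (rule act_in_span[OF \<open>x \<in> words_span S\<close>[unfolded words_span_def]])
        (use Hw in \<open>auto simp: words_span_def\<close>)
  qed (use Fw in simp)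
qed

lemma weight_vector_in_component:
  assumes G: "\<And>\<nu>. M.subspace (G \<nu>)" and wt: "\<And>\<nu> x. x \<in> G \<nu> \<Longrightarrow> weight_vector \<nu> x"
    and v: "v \<in> M.span (\<Union>\<nu>. G \<nu>)" "weight_vector \<mu> v"
  shows "v \<in> G \<mu>"
proof -
  obtain S y where S: "finite S" and y: "\<And>\<nu>. y \<nu> \<in> G \<nu>" and v_eq: "v = sum y S"
    using M.span_UN_subspaces[OF v(1) G] by blast
  define z where "z \<nu> = (if \<nu> \<in> S then y \<nu> else 0)" for \<nu>
  \<comment> \<open>With \<open>v\<close> subtracted in weight \<open>\<mu>\<close> the vectors sum
    to zero, so each vanishes. Both \<open>z\<close> and the index set \<open>insert \<mu> S\<close>
    allow for \<open>\<mu>\<close> outside \<open>S\<close>, where the component is zero.\<close>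
  define x where "x \<nu> = z \<nu> - (if \<nu> = \<mu> then v else 0)" for \<nu>
  have "sum z (insert \<mu> S) = sum z S"
    using S by (intro sum.mono_neutral_right) (auto simp: z_def)
  also have "\<dots> = v" unfolding v_eq by (rule sum.cong) (simp_all add: z_def)
  finally have sum: "sum x (insert \<mu> S) \<in> {0}" using S by (simp add: x_def sum_subtractf)
  have "weight_vector \<nu> (z \<nu>)" for \<nu>
    using wt[OF y[of \<nu>]] by (simp add: z_def weight_vector_def)
  then have eig: "act (H h) (x \<nu>) = scale_M (\<nu> h) (x \<nu>)" for \<nu> h
    using v(2) by (simp add: x_def weight_vector_def act_diff_right M.scale_right_diff_distrib)
  have "x \<mu> \<in> {0}"
  proof (rule M.eigencomponents_in_subspace[where S = "insert \<mu> S" and D = "\<lambda>h. act (H h)"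
        and ev = "\<lambda>\<nu>. \<nu>", OF _ _ linear_act _ eig _ sum])
    show "\<exists>k. \<nu> k \<noteq> \<nu>' k" if "\<nu> \<noteq> \<nu>'" for \<nu> \<nu>' :: "'h \<Rightarrow> complex"
      using that by (rule contrapos_np) (rule ext, simp)
  qed (use S in simp_all)
  then have "v = z \<mu>" by (simp add: x_def)
  then show ?thesis using y G M.subspace_0 by (auto simp: z_def)
qed

lemma submodule_weight_components:
  assumes G: "\<And>\<nu>. M.subspace (G \<nu>)" and wt: "\<And>\<nu> x. x \<in> G \<nu> \<Longrightarrow> weight_vector \<nu> x"
    and span: "M.span (\<Union>\<nu>. G \<nu>) = UNIV"
    and N: "M.subspace N" "\<And>h x. x \<in> N \<Longrightarrow> act (H h) x \<in> N" and "v \<in> N"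
  shows "v \<in> M.span {x \<in> N. \<exists>\<nu>. weight_vector \<nu> x}"
proof -
  have v: "v \<in> M.span (\<Union>\<nu>. G \<nu>)" by (simp add: span)
  obtain S y where S: "finite S" and y: "\<And>\<nu>. y \<nu> \<in> G \<nu>" and v_eq: "v = sum y S"
    using M.span_UN_subspaces[OF v G] by blast
  have "y \<nu> \<in> N" if "\<nu> \<in> S" for \<nu>
  proof (rule M.eigencomponents_in_subspace[where S = S and D = "\<lambda>h. act (H h)"
        and ev = "\<lambda>\<nu>. \<nu>", OF N(1) N(2) linear_act S _ _ _ that])
    show "\<exists>k. \<nu> k \<noteq> \<nu>' k" if "\<nu> \<noteq> \<nu>'" for \<nu> \<nu>' :: "'h \<Rightarrow> complex"
      using that by (rule contrapos_np) (rule ext, simp)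
    show "act (H h) (y \<nu>) = scale_M (\<nu> h) (y \<nu>)" for \<nu> h
      using wt[OF y] by (simp add: weight_vector_def)
    show "sum y S \<in> N" using \<open>v \<in> N\<close> v_eq by simp
  qed
  then show ?thesis unfolding v_eq using wt[OF y] by (intro M.span_sum M.span_base) auto
qed

section \<open>Raising operators on words\<close>

lemma e_act_word:
  assumes "i \<notin> set w"
  shows "act (e i) (word_act w x) = word_act w (act (e i) x)"
  using assms by (induction w) (auto simp: e_act_f)

text \<open>The sl2 formula for a vector killed by \<open>e i\<close>: the step from
  \<open>k\<close> to \<open>k + 1\<close> adds the coroot value \<open>s - 2 (k + 1)\<close> of the
  weight reached. The factor at \<open>k\<close> is zero only for \<open>s = k\<close>.\<close>

lemma e_act_f_power:
  assumes "\<alpha> i (\<alpha>v i) = 2" and "act (e i) x = 0" and "act (H (\<alpha>v i)) x = scale_M s x"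
  shows "act (e i) (word_act (replicate (Suc k) i) x) =
    scale_M (of_nat (Suc k) * (s - of_nat k)) (word_act (replicate k i) x)"
proof (induction k)
  case 0
  then show ?case using assms by (simp add: e_act_f)
next
  case (Suc k)
  let ?y = "word_act (replicate (Suc k) i) x"
  have "act (e i) (word_act (replicate (Suc (Suc k)) i) x) =
      act (f i) (act (e i) ?y) + act (H (\<alpha>v i)) ?y"
    unfolding replicate_Suc[of "Suc k"] word_act_simps by (simp only: e_act_f simp_thms if_True)
  also have "act (f i) (act (e i) ?y) = scale_M (of_nat (Suc k) * (s - of_nat k)) ?y"
    unfolding Suc act_scale_right by (simp only: replicate_Suc word_act_simps)
  also have "act (H (\<alpha>v i)) ?y = scale_M (s - 2 * of_nat (Suc k)) ?y"
    by (simp only: h_act_word assms word_act_scale word_weight_replicate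
        M.scale_left_diff_distrib mult.commute)
  finally have "act (e i) (word_act (replicate (Suc (Suc k)) i) x) =
      scale_M (of_nat (Suc k) * (s - of_nat k) + (s - 2 * of_nat (Suc k))) ?y"
    by (simp only: M.scale_left_distrib)
  also have "of_nat (Suc k) * (s - of_nat k) + (s - 2 * of_nat (Suc k)) =
      of_nat (Suc (Suc k)) * (s - of_nat (Suc k))"
    by (simp add: algebra_simps)
  finally show ?case .
qed

text \<open>
  \<open>s\<close> is the value of the coroot on the weight of \<open>x\<close>; the hypothesis on it says that raising
  \<open>f\<^sub>i\<^sup>k x\<close> back to \<open>x\<close> by \<open>e\<^sub>i\<^sup>k\<close> introduces only nonzero factors.
\<close>

lemma strip_f_power:
  assumes N: "M.subspace N" "\<And>i x. x \<in> N \<Longrightarrow> act (e i) x \<in> N"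
    and x: "\<alpha> i (\<alpha>v i) = 2" "act (e i) x = 0" "act (H (\<alpha>v i)) x = scale_M s x"
    and s: "\<And>r. r < k \<Longrightarrow> s \<noteq> of_nat r" and u: "i \<notin> set u"
    and mem: "word_act (u @ replicate k i) x \<in> N"
  shows "word_act u x \<in> N"
  using s mem
proof (induction k)
  case (Suc k)
  let ?a = "of_nat (Suc k) * (s - of_nat k)"
  have a: "?a \<noteq> 0" using Suc.prems(1)[of k] by (simp del: of_nat_Suc)
  have "act (e i) (word_act (u @ replicate (Suc k) i) x) \<in> N" using N(2) Suc.prems(2) by blast
  also have "act (e i) (word_act (u @ replicate (Suc k) i) x) =
      scale_M ?a (word_act (u @ replicate k i) x)"
    by (simp only: word_act_simps(3) e_act_word[OF u] e_act_f_power[OF x] word_act_scale)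
  finally have "scale_M (inverse ?a) (scale_M ?a (word_act (u @ replicate k i) x)) \<in> N"
    by (rule M.subspace_scale[OF N(1)])
  then have "word_act (u @ replicate k i) x \<in> N"
    by (simp only: M.scale_scale left_inverse[OF a] M.scale_one)
  with Suc show ?case by simp
qed simp

text \<open>
  Order the simple roots as follows: first (rightmost in the word) those for which \<open>\<Lambda>(\<alpha>\<^sub>i\<^sup>\<or>)\<close> is
  not a natural number, then an independent set \<open>J\<close> chosen greedily by decreasing exponent, then
  all others. Every remaining root has a neighbour in \<open>J\<close> with an exponent at least as large, so
  all factors outside \<open>J\<close> can be stripped off.
\<close>

lemma exists_word_outside_submodule:
  assumes N: "M.subspace N" "\<And>i x. x \<in> N \<Longrightarrow> act (e i) x \<in> N"
    and m: "\<And>i. act (e i) m = 0" "weight_vector \<Lambda> m"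
    and diag: "\<And>i. \<alpha> i (\<alpha>v i) = 2"
    and off: "\<And>i j. i \<noteq> j \<Longrightarrow> \<exists>n::nat. \<alpha> j (\<alpha>v i) = - of_nat n"
    and sym: "\<And>i j. \<alpha> j (\<alpha>v i) = 0 \<Longrightarrow> \<alpha> i (\<alpha>v j) = 0"
    and indep: "\<And>w. \<not> has_dynkin_edge \<alpha> \<alpha>v (set w) \<Longrightarrow> word_act w m \<notin> N"
  shows "\<exists>w. count_list w = c \<and> word_act w m \<notin> N"
proof -
  define P where "P = {i. \<Lambda> (\<alpha>v i) \<in> \<nat>}"
  obtain J where J: "J \<subseteq> P"
    and J1: "\<forall>i\<in>J. \<forall>j\<in>J. i \<noteq> j \<longrightarrow> \<not> \<alpha> j (\<alpha>v i) \<noteq> 0 \<and> \<not> \<alpha> i (\<alpha>v j) \<noteq> 0"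
    and J2: "\<forall>i\<in>P - J. \<exists>j\<in>J. (\<alpha> j (\<alpha>v i) \<noteq> 0 \<or> \<alpha> i (\<alpha>v j) \<noteq> 0) \<and> c i \<le> c j"
    using greedy_independent_subset[OF finite, of P "\<lambda>i j. \<alpha> j (\<alpha>v i) \<noteq> 0" c]
    by (elim exE conjE) (rule that)
  have Jind: "\<alpha> i (\<alpha>v j) = 0" if "i \<in> J" "j \<in> J" "i \<noteq> j" for i j
    using J1 that by simp
  have Jdom: "\<exists>j\<in>J. \<alpha> j (\<alpha>v i) \<noteq> 0 \<and> c i \<le> c j" if "i \<in> P - J" for i
    using J2[rule_format, OF that] sym[of _ i] by auto
  obtain js where js: "set js = J" "distinct js" using finite_distinct_list[of J] by auto
  obtain rs where rs: "set rs = P - J" "distinct rs" using finite_distinct_list[of "P - J"] by auto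
  obtain qs where qs: "set qs = - P" "distinct qs" using finite_distinct_list[of "- P"] by auto
  have strip_right: "word_act u m \<in> N"
    if "word_act (u @ blocks c l) m \<in> N" "set l \<subseteq> - P" "distinct l" "set u \<inter> set l = {}" for u l
    using that
  proof (induction l rule: rev_induct)
    case (snoc i l)
    \<comment> \<open>The last block acts on \<open>m\<close> itself, where the coroot value is not
      a natural number, so no raising factor vanishes; \<open>e i\<close> passes through everything
      to its left.\<close>
    have "word_act (u @ blocks c l) m \<in> N"
    proof (rule strip_f_power[OF N diag m(1), where k = "c i" and i = i])
      show "act (H (\<alpha>v i)) m = scale_M (\<Lambda> (\<alpha>v i)) m" using m(2) by (simp add: weight_vector_def)
      show "\<Lambda> (\<alpha>v i) \<noteq> of_nat r" for r using snoc.prems(2) by (auto simp: P_def)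
      show "i \<notin> set (u @ blocks c l)" using snoc.prems by (auto simp: set_blocks)
    qed (use snoc.prems(1) in simp_all)
    with snoc show ?case by simp
  qed simp
  \<comment> \<open>Every occurrence in \<open>w\<close> of a neighbour of \<open>i\<close>
    contributes a negative integer to the coroot value of the word's weight, and no letter
    contributes a positive one as \<open>i\<close> is absent. So \<open>p\<close> bounds the
    exponent of each neighbour.\<close>
  have pairing: "\<exists>p::nat. word_weight \<alpha> w (\<alpha>v i) = - of_nat p \<and>
      (\<forall>j. \<alpha> j (\<alpha>v i) \<noteq> 0 \<longrightarrow> count_list w j \<le> p)" if "i \<notin> set w" for w i
    using that
  proof (induction w)
    case (Cons k w)
    then obtain p where p: "word_weight \<alpha> w (\<alpha>v i) = - of_nat p"
      "\<And>j. \<alpha> j (\<alpha>v i) \<noteq> 0 \<Longrightarrow> count_list w j \<le> p" by auto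
    obtain n where n: "\<alpha> k (\<alpha>v i) = - of_nat n" using off Cons.prems by force
    show ?case
    proof (intro exI[of _ "n + p"] conjI allI impI)
      show "word_weight \<alpha> (k # w) (\<alpha>v i) = - of_nat (n + p)" by (simp add: p n)
      show "count_list (k # w) j \<le> n + p" if "\<alpha> j (\<alpha>v i) \<noteq> 0" for j
        using p(2)[OF that] n that by (cases "n = 0") auto
    qed
  qed simp
  have strip_left: "word_act v m \<in> N"
    if "word_act (blocks c l @ v) m \<in> N" "set l \<subseteq> P - J" "distinct l" "set v \<inter> set l = {}"
      "\<And>j. j \<in> J \<Longrightarrow> count_list v j = c j" for v l
    using that
  proof (induction l)
    case (Cons i l)
    let ?w = "blocks c l @ v"
    have i: "i \<notin> set ?w" using Cons.prems by (auto simp: set_blocks)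
    have "word_act [] (word_act ?w m) \<in> N"
    proof (rule strip_f_power[OF N diag, where k = "c i" and i = i])
      show "act (e i) (word_act ?w m) = 0" using e_act_word[OF i] m(1) by simp
      show "act (H (\<alpha>v i)) (word_act ?w m) =
          scale_M (\<Lambda> (\<alpha>v i) - word_weight \<alpha> ?w (\<alpha>v i)) (word_act ?w m)"
        using weight_vector_word_act[OF m(2), of ?w]
        by (simp add: weight_vector_def del: word_act_simps word_weight_simps)
      obtain n where n: "\<Lambda> (\<alpha>v i) = of_nat n" using Cons.prems(2) by (auto simp: P_def elim: Nats_cases)
      obtain p where p: "word_weight \<alpha> ?w (\<alpha>v i) = - of_nat p"
        "\<And>j. \<alpha> j (\<alpha>v i) \<noteq> 0 \<Longrightarrow> count_list ?w j \<le> p" using pairing[OF i] by blast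
      obtain j where j: "j \<in> J" "\<alpha> j (\<alpha>v i) \<noteq> 0" "c i \<le> c j" using Jdom Cons.prems(2) by auto
      \<comment> \<open>The coroot value on the weight of the remaining word is
        \<open>n + p\<close>, at least the exponent \<open>c i\<close>, hence different from each
        \<open>r < c i\<close>.\<close>
      have "c i \<le> p" using p(2)[OF j(2)] j Cons.prems(5)[OF j(1)] by simp
      then show "\<Lambda> (\<alpha>v i) - word_weight \<alpha> ?w (\<alpha>v i) \<noteq> of_nat r" if "r < c i" for r
        using that by (auto simp: n p(1) simp del: word_weight_simps simp flip: of_nat_add)
    qed (use Cons.prems(1) in auto)
    with Cons show ?case by simp
  qed simp
  show ?thesis
  proof (intro exI conjI)
    let ?w = "(blocks c rs @ blocks c js) @ blocks c qs"
    show "count_list ?w = c"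
      using js rs qs J by (auto simp: count_list_blocks fun_eq_iff)
    have "\<not> has_dynkin_edge \<alpha> \<alpha>v (set (blocks c js))"
      using Jind js by (auto simp: has_dynkin_edge_def set_blocks)
    then have "word_act (blocks c js) m \<notin> N" by (rule indep)
    moreover have "count_list (blocks c js) j = c j" if "j \<in> J" for j
      using that js by (simp add: count_list_blocks)
    \<comment> \<open>Membership is traced backwards: the non-natural roots \<open>qs\<close> are
      stripped from the right before the others are stripped from the left. Hence the block of
      \<open>J\<close> is applied directly to \<open>m\<close> here.\<close>
    ultimately have "word_act (blocks c rs @ blocks c js) m \<notin> N"
      using strip_left[of rs "blocks c js"] js rs by (auto simp: set_blocks)
    then show "word_act ?w m \<notin> N"
      using strip_right[of "blocks c rs @ blocks c js" qs] js rs qs J by (auto simp: set_blocks)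
  qed
qed

lemma words_commute:
  assumes "\<And>i j. i \<in> set w \<Longrightarrow> j \<in> set w \<Longrightarrow> bracket (f i) (f j) = 0"
    and "mset u = mset w"
  shows "word_act u x = word_act w x"
proof -
  have comm: "act (f i) (act (f j) y) = act (f j) (act (f i) y)" if "i \<in> set w" "j \<in> set w" for i j y
    using act_bracket[of "f i" "f j" y] assms(1)[OF that] by simp
  have pull: "word_act (v @ i # v') y = word_act (i # v @ v') y"
    if "i \<in> set w" "set v \<subseteq> set w" for i v v' y
    using that(2)
  proof (induction v)
    case (Cons k v)
    then have "word_act (v @ i # v') y = word_act (i # v @ v') y" by simp
    then have "word_act ((k # v) @ i # v') y = act (f k) (act (f i) (word_act (v @ v') y))"
      by (simp del: word_act_simps(3))
    also have "\<dots> = act (f i) (act (f k) (word_act (v @ v') y))"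
      by (rule comm) (use that(1) Cons.prems in simp_all)
    finally show ?case by simp
  qed simp
  have "word_act u x = word_act v x" if "mset u = mset v" "set v \<subseteq> set w" for u v
    using that
  proof (induction v arbitrary: u)
    case (Cons i v)
    have su: "set u = set (i # v)" by (rule mset_eq_setD) fact
    then have "i \<in> set u" by simp
    then obtain u1 u2 where u: "u = u1 @ i # u2" by (meson split_list)
    then have mv: "mset (u1 @ u2) = mset v" using Cons.prems(1) by simp
    have "set u1 \<subseteq> set w" using Cons.prems(2) u su by auto
    moreover have "word_act (u1 @ u2) x = word_act v x"
      by (rule Cons.IH[OF mv]) (use Cons.prems(2) in simp)
    ultimately show ?case using pull[of i u1 u2 x] Cons.prems(2) u by simp
  qed simp
  from this[OF assms(2) subset_refl] show ?thesis .
qed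

end

section \<open>The word module of the auxiliary algebra\<close>

text \<open>Linear operators on a function space, made a type because a Lie algebra here occupies a
  whole type.\<close>

typedef 'a endo = "{A :: ('a \<Rightarrow> complex) \<Rightarrow> 'a \<Rightarrow> complex.
    (\<forall>\<phi> \<psi>. A (\<phi> + \<psi>) = A \<phi> + A \<psi>) \<and> (\<forall>c \<phi>. A (\<lambda>u. c * \<phi> u) = (\<lambda>u. c * A \<phi> u))}"
  morphisms app Endo
  by (rule exI[of _ id]) simp

setup_lifting type_definition_endo

lemma app_add: "app A (\<phi> + \<psi>) = app A \<phi> + app A \<psi>"
  and app_scale: "app A (\<lambda>u. c * \<phi> u) = (\<lambda>u. c * app A \<phi> u)"
  using app[of A] by auto

instantiation endo :: (type) ring
begin

lift_definition zero_endo :: "'a endo" is "\<lambda>\<phi> u. 0" by (auto simp: fun_eq_iff)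
lift_definition plus_endo :: "'a endo \<Rightarrow> 'a endo \<Rightarrow> 'a endo" is "\<lambda>A B \<phi> u. A \<phi> u + B \<phi> u"
  by (auto simp: fun_eq_iff algebra_simps)
lift_definition minus_endo :: "'a endo \<Rightarrow> 'a endo \<Rightarrow> 'a endo" is "\<lambda>A B \<phi> u. A \<phi> u - B \<phi> u"
  by (auto simp: fun_eq_iff algebra_simps)
lift_definition uminus_endo :: "'a endo \<Rightarrow> 'a endo" is "\<lambda>A \<phi> u. - A \<phi> u"
  by (auto simp: fun_eq_iff algebra_simps)
lift_definition times_endo :: "'a endo \<Rightarrow> 'a endo \<Rightarrow> 'a endo" is "\<lambda>A B \<phi>. A (B \<phi>)"
  by auto

instance
proof
  fix A B C :: "'a endo"
  show "A * (B + C) = A * B + A * C"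
  proof transfer
    fix A B C :: "('a \<Rightarrow> complex) \<Rightarrow> 'a \<Rightarrow> complex"
    assume "(\<forall>\<phi> \<psi>. A (\<phi> + \<psi>) = A \<phi> + A \<psi>) \<and> (\<forall>c \<phi>. A (\<lambda>u. c * \<phi> u) = (\<lambda>u. c * A \<phi> u))"
    then have "A (B \<phi> + C \<phi>) = A (B \<phi>) + A (C \<phi>)" for \<phi> by blast
    then show "(\<lambda>\<phi>. A (\<lambda>u. B \<phi> u + C \<phi> u)) = (\<lambda>\<phi> u. A (B \<phi>) u + A (C \<phi>) u)"
      by (simp add: fun_eq_iff plus_fun_def)
  qed
qed (transfer; auto simp: fun_eq_iff)+

end

lift_definition scale_endo :: "complex \<Rightarrow> 'a endo \<Rightarrow> 'a endo" is "\<lambda>c A \<phi> u. c * A \<phi> u"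
  by (auto simp: fun_eq_iff algebra_simps)

definition commutator :: "'a endo \<Rightarrow> 'a endo \<Rightarrow> 'a endo" where
  "commutator A B = A * B - B * A"

definition scale_fun :: "complex \<Rightarrow> ('a \<Rightarrow> complex) \<Rightarrow> 'a \<Rightarrow> complex" where
  "scale_fun c \<phi> = (\<lambda>u. c * \<phi> u)"

lemma app_simps:
  "app 0 \<phi> u = 0" "app (A + B) \<phi> u = app A \<phi> u + app B \<phi> u"
  "app (A - B) \<phi> u = app A \<phi> u - app B \<phi> u" "app (scale_endo c A) \<phi> u = c * app A \<phi> u"
  "app (A * B) \<phi> u = app A (app B \<phi>) u" "app (- A) \<phi> u = - app A \<phi> u"
  by (transfer; simp)+

lemma endo_eqI: "(\<And>\<phi> u. app A \<phi> u = app B \<phi> u) \<Longrightarrow> A = B"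
  by (simp add: app_inject[symmetric] fun_eq_iff)

lemma app_diff: "app A (\<phi> - \<psi>) = app A \<phi> - app A \<psi>"
  using app_add[of A "\<phi> - \<psi>" \<psi>] by simp

lemma vector_space_endo: "vector_space scale_endo"
  by unfold_locales (rule endo_eqI, simp add: app_simps algebra_simps)+

lemma app_scale_arg: "app A (app (scale_endo c B) \<phi>) = (\<lambda>u. c * app A (app B \<phi>) u)"
proof -
  have "app (scale_endo c B) \<phi> = (\<lambda>u. c * app B \<phi> u)" by (simp add: fun_eq_iff app_simps)
  then show ?thesis by (simp add: app_scale)
qed

lemma lie_algebra_endo: "lie_algebra scale_endo commutator"
proof -
  interpret vector_space scale_endo by (rule vector_space_endo)
  have left: "scale_endo c (A * B) = scale_endo c A * B"
    and right: "scale_endo c (A * B) = A * scale_endo c B" for c and A B :: "'a endo"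
    by (rule endo_eqI, simp add: app_simps app_scale_arg)+
  show ?thesis
    by unfold_locales
      (simp_all add: commutator_def distrib_left distrib_right left_diff_distrib right_diff_distrib
        mult.assoc scale_right_diff_distrib left[symmetric] right[symmetric])
qed

lemma vector_space_scale_fun: "vector_space scale_fun"
  by unfold_locales (auto simp: scale_fun_def fun_eq_iff algebra_simps)

lemma lie_module_endo: "lie_module scale_endo commutator scale_fun app"
proof -
  interpret lie_algebra scale_endo commutator by (rule lie_algebra_endo)
  interpret M: vector_space scale_fun by (rule vector_space_scale_fun)
  show ?thesis
    by unfold_locales
      (auto simp: fun_eq_iff app_simps app_add app_scale commutator_def scale_fun_def)
qed

context
  fixes \<alpha> :: "'i \<Rightarrow> 'h :: ab_group_add \<Rightarrow> complex" and \<alpha>v :: "'i \<Rightarrow> 'h"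
begin

text \<open>
  The auxiliary algebra acts on the free module over the free algebra on the \<open>f i\<close>; a word stands
  for the corresponding monomial applied to a highest weight vector of weight \<open>\<Lambda>\<close>. The functions
  on words need not have finite support.
\<close>

primrec raise :: "('h \<Rightarrow> complex) \<Rightarrow> 'i \<Rightarrow> 'i list \<Rightarrow> ('i list \<Rightarrow> complex) \<Rightarrow> complex" where
  "raise \<Lambda> i [] \<phi> = \<Lambda> (\<alpha>v i) * \<phi> [i]"
| "raise \<Lambda> i (j # u) \<phi> =
     (\<Lambda> (\<alpha>v i) - word_weight \<alpha> (j # u) (\<alpha>v i)) * \<phi> (i # j # u) + raise \<Lambda> i u (\<lambda>w. \<phi> (j # w))"

lemma raise_add: "raise \<Lambda> i u (\<phi> + \<psi>) = raise \<Lambda> i u \<phi> + raise \<Lambda> i u \<psi>"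
proof (induction u arbitrary: \<phi> \<psi>)
  case (Cons j u)
  from Cons[of "\<lambda>w. \<phi> (j # w)" "\<lambda>w. \<psi> (j # w)"] show ?case
    by (simp add: plus_fun_def algebra_simps)
qed (simp add: algebra_simps)

lemma raise_scale: "raise \<Lambda> i u (\<lambda>w. c * \<phi> w) = c * raise \<Lambda> i u \<phi>"
  by (induction u arbitrary: \<phi>) (simp_all add: algebra_simps)

lemma raise_zero: "raise \<Lambda> i u (\<lambda>w. 0) = 0"
  using raise_scale[of \<Lambda> i u 0] by simp

text \<open>\<open>raise\<close> gives the coefficient at \<open>u\<close> of the raised vector: the
  contributing words are \<open>u\<close> with one \<open>i\<close> inserted, each weighted by the
  coroot value at the weight of the suffix behind that \<open>i\<close>. This sum is finite even
  when the support of the vector is infinite.\<close>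

lift_definition word_e :: "('h \<Rightarrow> complex) \<Rightarrow> 'i \<Rightarrow> 'i list endo" is
  "\<lambda>\<Lambda> i \<phi> u. raise \<Lambda> i u \<phi>"
  by (auto simp: fun_eq_iff raise_add raise_scale)

lift_definition word_f :: "'i \<Rightarrow> 'i list endo" is
  "\<lambda>i \<phi> u. case u of [] \<Rightarrow> 0 | j # w \<Rightarrow> if j = i then \<phi> w else 0"
  by (auto simp: fun_eq_iff split: list.splits)

lift_definition word_h :: "('h \<Rightarrow> complex) \<Rightarrow> 'h \<Rightarrow> 'i list endo" is
  "\<lambda>\<Lambda> h \<phi> u. (\<Lambda> h - word_weight \<alpha> u h) * \<phi> u"
  by (auto simp: fun_eq_iff algebra_simps)

definition word_gen :: "('h \<Rightarrow> complex) \<Rightarrow> ('i, 'h) km_gen \<Rightarrow> 'i list endo" where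
  "word_gen \<Lambda> g = (case g of Gen_e i \<Rightarrow> word_e \<Lambda> i | Gen_f i \<Rightarrow> word_f i | Gen_h h \<Rightarrow> word_h \<Lambda> h)"

lemma word_gen_simps:
  "app (word_gen \<Lambda> (Gen_e i)) \<phi> u = raise \<Lambda> i u \<phi>"
  "app (word_gen \<Lambda> (Gen_f i)) \<phi> [] = 0"
  "app (word_gen \<Lambda> (Gen_f i)) \<phi> (j # w) = (if j = i then \<phi> w else 0)"
  "app (word_gen \<Lambda> (Gen_h h)) \<phi> u = (\<Lambda> h - word_weight \<alpha> u h) * \<phi> u"
  by (simp_all add: word_gen_def) (transfer; simp)+

text \<open>The coefficient form of \<open>[h, e i] = \<alpha> i(h) e i\<close>: inserting
  \<open>i\<close> shifts the weight by \<open>\<alpha> i\<close>. The number \<open>s\<close> is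
  free because peeling off a letter \<open>j\<close> replaces it by
  \<open>s - \<alpha> j h\<close>.\<close>

lemma raise_weighted:
  "raise \<Lambda> i u (\<lambda>w. (s - word_weight \<alpha> w h) * \<phi> w) =
     (s - word_weight \<alpha> u h - \<alpha> i h) * raise \<Lambda> i u \<phi>"
proof (induction u arbitrary: s \<phi>)
  case (Cons j u)
  from Cons[of "s - \<alpha> j h" "\<lambda>w. \<phi> (j # w)"] show ?case
    by (simp add: algebra_simps)
qed (simp add: algebra_simps)

lemma raise_word_f:
  "raise \<Lambda> i u (app (word_gen \<Lambda> (Gen_f j)) \<phi>) =
     app (word_gen \<Lambda> (Gen_f j)) (\<lambda>u. raise \<Lambda> i u \<phi>) u +
     (if i = j then (\<Lambda> (\<alpha>v i) - word_weight \<alpha> u (\<alpha>v i)) * \<phi> u else 0)"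
proof (cases u)
  case (Cons k v)
  have "raise \<Lambda> i v (\<lambda>w. if k = j then \<phi> w else 0) = (if k = j then raise \<Lambda> i v \<phi> else 0)"
    by (simp add: raise_zero)
  then show ?thesis by (simp add: Cons word_gen_simps)
qed (simp add: word_gen_simps)

end

lemma chevalley_word_gen:
  fixes \<alpha> :: "'i :: finite \<Rightarrow> 'h :: ab_group_add \<Rightarrow> complex"
  assumes "vector_space scale_h" and "\<And>i. linear_functional scale_h (\<alpha> i)"
    and "linear_functional scale_h \<Lambda>"
  shows "chevalley scale_endo commutator scale_h \<alpha> \<alpha>v (word_gen \<alpha> \<alpha>v \<Lambda>)"
proof -
  interpret lie_algebra scale_endo commutator by (rule lie_algebra_endo)
  have \<Lambda>: "\<Lambda> (x + y) = \<Lambda> x + \<Lambda> y" "\<Lambda> (scale_h a x) = a * \<Lambda> x" for x y a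
    using assms(3) by (simp_all add: linear_functional_iff[OF assms(1)])
  have \<alpha>: "\<alpha> i (x + y) = \<alpha> i x + \<alpha> i y" "\<alpha> i (scale_h a x) = a * \<alpha> i x" for i x y a
    using assms(2) by (simp_all add: linear_functional_iff[OF assms(1)])
  have wt: "word_weight \<alpha> w (x + y) = word_weight \<alpha> w x + word_weight \<alpha> w y"
    "word_weight \<alpha> w (scale_h a x) = a * word_weight \<alpha> w x" for w x y a
    by (induction w) (simp_all add: \<alpha> algebra_simps)
  let ?g = "word_gen \<alpha> \<alpha>v \<Lambda>"
  show ?thesis
  proof
    fix x y :: 'h and a and i j :: 'i
    show "?g (Gen_h (x + y)) = ?g (Gen_h x) + ?g (Gen_h y)"
      by (rule endo_eqI) (simp add: word_gen_simps app_simps \<Lambda> wt algebra_simps)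
    show "?g (Gen_h (scale_h a x)) = scale_endo a (?g (Gen_h x))"
      by (rule endo_eqI) (simp add: word_gen_simps app_simps \<Lambda> wt algebra_simps)
    have e: "app (?g (Gen_e i)) \<phi> = (\<lambda>u. raise \<alpha> \<alpha>v \<Lambda> i u \<phi>)"
      and h: "app (?g (Gen_h x)) \<phi> = (\<lambda>u. (\<Lambda> x - word_weight \<alpha> u x) * \<phi> u)" for \<phi> i x
      by (simp_all add: fun_eq_iff word_gen_simps)
    show "commutator (?g (Gen_e i)) (?g (Gen_f j)) = (if i = j then ?g (Gen_h (\<alpha>v i)) else 0)"
    proof (rule endo_eqI)
      fix \<phi> u
      show "app (commutator (?g (Gen_e i)) (?g (Gen_f j))) \<phi> u =
          app (if i = j then ?g (Gen_h (\<alpha>v i)) else 0) \<phi> u"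
        by (cases "i = j") (simp_all add: commutator_def app_simps e h raise_word_f)
    qed
    show "commutator (?g (Gen_h x)) (?g (Gen_h y)) = 0"
      by (rule endo_eqI) (simp add: commutator_def app_simps h)
    show "commutator (?g (Gen_h x)) (?g (Gen_e i)) = scale_endo (\<alpha> i x) (?g (Gen_e i))"
      by (rule endo_eqI) (simp add: commutator_def app_simps e h raise_weighted, simp add: algebra_simps)
    show "commutator (?g (Gen_h x)) (?g (Gen_f i)) = scale_endo (- \<alpha> i x) (?g (Gen_f i))"
    proof (rule endo_eqI)
      fix \<phi> u
      show "app (commutator (?g (Gen_h x)) (?g (Gen_f i))) \<phi> u =
          app (scale_endo (- \<alpha> i x) (?g (Gen_f i))) \<phi> u"
        by (cases u) (auto simp: commutator_def app_simps h word_gen_simps algebra_simps)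
    qed
  qed
qed

section \<open>The vacuum vector and abelianization\<close>

definition vacuum :: "'i list \<Rightarrow> complex" where
  "vacuum u = (if u = [] then 1 else 0)"

lemma e_vacuum: "app (word_gen \<alpha> \<alpha>v \<Lambda> (Gen_e i)) vacuum = 0"
proof -
  \<comment> \<open>The prefix \<open>v\<close> collects the letters that the recursion of
    \<open>raise\<close> has peeled off.\<close>
  have "raise \<alpha> \<alpha>v \<Lambda> i u (\<lambda>w. if v @ w = [] then 1 else 0) = 0" for u v
    by (induction u arbitrary: v) (use raise_zero in \<open>auto\<close>)
  from this[of _ "[]"] show ?thesis by (simp add: fun_eq_iff word_gen_simps vacuum_def[abs_def])
qed

lemma h_vacuum: "app (word_gen \<alpha> \<alpha>v \<Lambda> (Gen_h h)) vacuum = scale_fun (\<Lambda> h) vacuum"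
  by (auto simp: fun_eq_iff word_gen_simps vacuum_def scale_fun_def)

text \<open>The projection from the free algebra on the \<open>f i\<close> to commutative
  polynomials, with multisets as monomials. A multiset has finitely many orderings, so infinite
  support is harmless.\<close>

definition abelianize :: "('i list \<Rightarrow> complex) \<Rightarrow> 'i multiset \<Rightarrow> complex" where
  "abelianize \<phi> c = (\<Sum>w | mset w = c. \<phi> w)"

lemma abelianize_add: "abelianize (\<phi> + \<psi>) c = abelianize \<phi> c + abelianize \<psi> c"
  and abelianize_diff: "abelianize (\<phi> - \<psi>) c = abelianize \<phi> c - abelianize \<psi> c"
  and abelianize_scale: "abelianize (scale_fun a \<phi>) c = a * abelianize \<phi> c"
  and abelianize_zero: "abelianize 0 c = 0"
  by (simp_all add: abelianize_def sum.distrib sum_subtractf sum_distrib_left scale_fun_def)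

text \<open>Only words that start with \<open>i\<close> contribute, so \<open>f i\<close> becomes
  multiplication by a variable.\<close>

lemma abelianize_f:
  "abelianize (app (word_gen \<alpha> \<alpha>v \<Lambda> (Gen_f i)) \<phi>) c =
     (if i \<in># c then abelianize \<phi> (c - {#i#}) else 0)"
proof -
  let ?f = "app (word_gen \<alpha> \<alpha>v \<Lambda> (Gen_f i)) \<phi>"
  have nz: "?f w = 0" if "\<nexists>v. w = i # v" for w
    using that by (cases w) (auto simp: word_gen_simps)
  show ?thesis
  proof (cases "i \<in># c")
    case True
    have "(\<Sum>w | mset w = c. ?f w) = (\<Sum>w \<in> (#) i ` {w. mset w = c - {#i#}}. ?f w)"
    proof (rule sum.mono_neutral_right)
      show "(#) i ` {w. mset w = c - {#i#}} \<subseteq> {w. mset w = c}" using True by auto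
      show "\<forall>w\<in>{w. mset w = c} - (#) i ` {w. mset w = c - {#i#}}. ?f w = 0"
        by (intro ballI nz) auto
      obtain w where "mset w = c" using ex_mset by blast
      then show "finite {w. mset w = c}" using mset_eq_finite[of w] by simp
    qed
    also have "\<dots> = abelianize \<phi> (c - {#i#})"
      by (simp add: sum.reindex abelianize_def word_gen_simps)
    finally show ?thesis using True by (simp add: abelianize_def)
  next
    case False
    have "?f w = 0" if "mset w = c" for w
      by (rule nz) (use that False in auto)
    then show ?thesis using False by (simp add: abelianize_def)
  qed
qed

lemma alg_eval_prod:
  "alg_eval (\<lambda>c p. (s1 c (fst p), s2 c (snd p))) (\<lambda>p q. (b1 (fst p) (fst q), b2 (snd p) (snd q)))
     (\<lambda>g. (g1 g, g2 g)) t = (alg_eval s1 b1 g1 t, alg_eval s2 b2 g2 t)"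
  by (induction t) (simp_all add: zero_prod_def)

text \<open>In the product, one term is evaluated in two algebras at once. A single decomposition
  into graded pieces then serves \<open>g(A)\<close> and the operators on words
  simultaneously.\<close>

lemma chevalley_prod:
  assumes "chevalley s1 b1 scale_h \<alpha> \<alpha>v g1" and "chevalley s2 b2 scale_h \<alpha> \<alpha>v g2"
  shows "chevalley (\<lambda>c p. (s1 c (fst p), s2 c (snd p)))
    (\<lambda>p q. (b1 (fst p) (fst q), b2 (snd p) (snd q))) scale_h \<alpha> \<alpha>v (\<lambda>g. (g1 g, g2 g))"
proof -
  interpret A: chevalley s1 b1 scale_h \<alpha> \<alpha>v g1 by fact
  interpret B: chevalley s2 b2 scale_h \<alpha> \<alpha>v g2 by fact
  show ?thesis
    by unfold_locales
      (simp_all add: A.scale_right_distrib B.scale_right_distrib A.scale_left_distrib B.scale_left_distrib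
        A.bracket_add_left B.bracket_add_left A.bracket_add_right B.bracket_add_right
        A.bracket_scale_left B.bracket_scale_left A.bracket_scale_right B.bracket_scale_right
        A.bracket_self B.bracket_self A.jacobi B.jacobi A.h_add B.h_add A.h_scale B.h_scale
        A.e_f B.e_f A.h_h B.h_h A.h_e B.h_e A.h_f B.h_f zero_prod_def)
qed

section \<open>The Kac--Moody algebra and its Verma modules\<close>

locale kac_moody =
  fixes A :: "int ^ 'i ^ 'i"
    and scale_h :: "complex \<Rightarrow> 'h :: ab_group_add \<Rightarrow> 'h"
    and \<alpha> :: "'i \<Rightarrow> 'h \<Rightarrow> complex" and \<alpha>v :: "'i \<Rightarrow> 'h"
    and scale_g :: "complex \<Rightarrow> 'g :: ab_group_add \<Rightarrow> 'g"
    and bracket :: "'g \<Rightarrow> 'g \<Rightarrow> 'g" and gen :: "('i, 'h) km_gen \<Rightarrow> 'g"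
  assumes gcm: "generalized_cartan_matrix A"
    and realization: "realization A scale_h \<alpha> \<alpha>v"
    and km: "kac_moody_algebra scale_h \<alpha> \<alpha>v scale_g bracket gen"
begin

sublocale chevalley scale_g bracket scale_h \<alpha> \<alpha>v gen
  by (rule kac_moody_algebra_chevalley[OF km])

sublocale Cartan: vector_space scale_h
  using realization by (simp add: realization_def)

abbreviation "\<rho> \<Lambda> \<equiv> alg_eval scale_endo commutator (word_gen \<alpha> \<alpha>v \<Lambda>)"

lemma linear_root: "linear_functional scale_h (\<alpha> i)"
  using realization by (simp add: realization_def)

lemma root_coroot: "\<alpha> j (\<alpha>v i) = of_int (A $ i $ j)"
  using realization by (simp add: realization_def)

lemma roots_independent:
  assumes "\<And>h. (\<Sum>i\<in>UNIV. c i * \<alpha> i h) = 0"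
  shows "c i = 0"
proof -
  have "(\<forall>h. (\<Sum>i\<in>UNIV. c i * \<alpha> i h) = 0) \<longrightarrow> (\<forall>i. c i = 0)"
    using realization unfolding realization_def by blast
  then show ?thesis using assms by simp
qed

lemma coroot_nonzero: "\<alpha>v i \<noteq> 0"
proof
  assume "\<alpha>v i = 0"
  moreover have "\<alpha> i (\<alpha>v i) = 2" using gcm by (simp add: root_coroot generalized_cartan_matrix_def)
  moreover have "\<alpha> i 0 = 0"
    using linear_root[of i] linear_functional_iff[OF Cartan.vector_space_axioms, of "\<alpha> i"]
    by (metis add_cancel_left_left)
  ultimately show False by simp
qed

lemma surj_eval: "surj eval"
  using km by (simp add: kac_moody_algebra_def)

lemma principal_grading_element:
  obtains h where "\<And>i. \<alpha> i h = 1"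
proof -
  have ind: "\<forall>i. c i = 0" if "\<forall>h. (\<Sum>i\<in>UNIV. c i * \<alpha> i h) = 0" for c
    using roots_independent[of c] that by simp
  obtain d where d: "\<And>i j. \<alpha> j (d i) = (if i = j then 1 else 0)"
    using linear_functionals_dual_family[of scale_h \<alpha>, OF Cartan.vector_space_axioms linear_root ind]
    by blast
  have "\<alpha> j (sum g S) = (\<Sum>s\<in>S. \<alpha> j (g s))" if "finite S" for j S and g :: "'i \<Rightarrow> 'h"
    using linear_root[of j] by (rule module_hom.sum[OF Vector_Spaces.linear.axioms(3)])
  then have "\<alpha> j (\<Sum>i\<in>UNIV. d i) = 1" for j by (simp add: d)
  then show thesis by (rule that)
qed

lemma chevalley_word:
  "linear_functional scale_h \<Lambda> \<Longrightarrow>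
    chevalley scale_endo commutator scale_h \<alpha> \<alpha>v (word_gen \<alpha> \<alpha>v \<Lambda>)"
  by (rule chevalley_word_gen[OF Cartan.vector_space_axioms linear_root])

lemma cartan_eq_zero_if_functionals:
  assumes "\<And>\<Lambda>. linear_functional scale_h \<Lambda> \<Longrightarrow> \<Lambda> h = 0"
  shows "h = 0"
  using exists_linear_functional_nonzero[OF Cartan.vector_space_axioms, of h] assms by blast

text \<open>The kernel avoids the Cartan subalgebra, so \<open>Gen_h h\<close> already vanishes in
  the auxiliary algebra; there it acts on the vacuum of every weight \<open>\<Lambda>\<close> by
  \<open>\<Lambda> h\<close>.\<close>

lemma H_eq_zero:
  assumes "H h = 0"
  shows "h = 0"
proof (rule cartan_eq_zero_if_functionals)
  fix \<Lambda> assume "linear_functional scale_h \<Lambda>"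
  then interpret W: chevalley scale_endo commutator scale_h \<alpha> \<alpha>v "word_gen \<alpha> \<alpha>v \<Lambda>"
    by (rule chevalley_word)
  have "cartan_avoiding_ideal scale_h \<alpha> \<alpha>v {t. eval t = 0}"
    using km by (simp add: kac_moody_algebra_def Let_def)
  then have "alg_cong (lie_relation (km_relation scale_h \<alpha> \<alpha>v)) (Gen (Gen_h h)) Zero"
    using assms unfolding cartan_avoiding_ideal_def by simp
  from W.eval_alg_cong[OF this] have "app (word_gen \<alpha> \<alpha>v \<Lambda> (Gen_h h)) vacuum [] = 0"
    by (simp add: app_simps)
  then show "\<Lambda> h = 0" by (simp add: word_gen_simps vacuum_def)
qed

end

locale kac_moody_weight = kac_moody A scale_h \<alpha> \<alpha>v scale_g bracket gen
  for A :: "int ^ 'i ^ 'i"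
    and scale_h :: "complex \<Rightarrow> 'h :: ab_group_add \<Rightarrow> 'h"
    and \<alpha> :: "'i \<Rightarrow> 'h \<Rightarrow> complex" and \<alpha>v :: "'i \<Rightarrow> 'h"
    and scale_g :: "complex \<Rightarrow> 'g :: ab_group_add \<Rightarrow> 'g"
    and bracket :: "'g \<Rightarrow> 'g \<Rightarrow> 'g" and gen :: "('i, 'h) km_gen \<Rightarrow> 'g" +
  fixes \<Lambda> :: "'h \<Rightarrow> complex"
  assumes linear_weight: "linear_functional scale_h \<Lambda>"
begin

sublocale T: chevalley_module scale_endo commutator scale_h \<alpha> \<alpha>v "word_gen \<alpha> \<alpha>v \<Lambda>" scale_fun app
proof -
  show "chevalley_module scale_endo commutator scale_h \<alpha> \<alpha>v (word_gen \<alpha> \<alpha>v \<Lambda>) scale_fun app"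
    by (intro chevalley_module.intro chevalley_word linear_weight lie_module_endo)
qed

lemma homogeneous_e_vacuum:
  assumes "T.homogeneous T.e d y"
  shows "app y vacuum = 0"
  using assms
proof (induction rule: T.homogeneous.induct)
  case (homogeneous_gen i)
  show ?case by (rule e_vacuum)
next
  case (homogeneous_bracket d y i)
  have "app (commutator (T.e i) y) vacuum = app (T.e i) 0 - app y 0"
    unfolding T.act_bracket e_vacuum homogeneous_bracket.IH ..
  then show ?case unfolding T.act_zero by simp
qed (simp_all add: T.act_add_left T.act_scale_left scale_fun_def fun_eq_iff)

text \<open>
  Abelianization kills every commutator in the subalgebra generated by the \<open>f i\<close>.
\<close>

lemma abelianize_homogeneous_f:
  assumes "T.homogeneous T.f d y"
  shows "(\<forall>i \<phi> c. abelianize (app y (app (T.f i) \<phi>)) c = abelianize (app (T.f i) (app y \<phi>)) c) \<and>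
    (d \<ge> 2 \<longrightarrow> (\<forall>\<phi> c. abelianize (app y \<phi>) c = 0))"
  using assms
proof (induction rule: T.homogeneous.induct)
  case (homogeneous_gen j)
  have "i \<in># c - {#j#} \<and> j \<in># c \<longleftrightarrow> j \<in># c - {#i#} \<and> i \<in># c" for i and c :: "'i multiset"
    by (cases "i = j") (auto simp: in_diff_count)
  then show ?case by (auto simp: abelianize_f add_mset_commute[of _ j] dest: in_diffD)
next
  case (homogeneous_bracket d y i)
  \<comment> \<open>The first conjunct for \<open>y\<close> kills the commutator. This is the second
    conjunct for the bracket, and it makes both sides of its first conjunct zero.\<close>
  then have "abelianize (app (commutator (T.f i) y) \<phi>) c = 0" for \<phi> c
    by (simp add: T.act_bracket abelianize_diff)
  then show ?case by (simp add: abelianize_f)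
next
  case (homogeneous_zero d)
  then show ?case by (simp add: abelianize_f) (simp add: abelianize_def)
next
  case (homogeneous_add d y z)
  from homogeneous_add.IH show ?case
    unfolding T.act_add_left T.act_add_right abelianize_add by simp
next
  case (homogeneous_scale d y a)
  from homogeneous_scale.IH show ?case
    unfolding T.act_scale_left T.act_scale_right abelianize_scale by simp
qed

text \<open>
  An element of the auxiliary algebra that vanishes in the Kac--Moody algebra is split into its
  graded pieces, which vanish there as well; hence the pieces of degree \<open>0\<close> and \<open>-1\<close> are zero.
\<close>

lemma abelianize_kernel:
  assumes "eval t = 0"
  shows "abelianize (app (\<rho> \<Lambda> t) vacuum) c = 0"
proof -
  let ?s = "\<lambda>c p. (scale_g c (fst p), scale_endo c (snd p))"
  let ?b = "\<lambda>p q. (bracket (fst p) (fst q), commutator (snd p) (snd q))"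
  interpret P: chevalley ?s ?b scale_h \<alpha> \<alpha>v "\<lambda>g. (gen g, word_gen \<alpha> \<alpha>v \<Lambda> g)"
    by (rule chevalley_prod) unfold_locales
  obtain S y where S: "finite S" and y: "\<And>d. y d \<in> P.piece d" and x: "P.eval t = sum y S"
    using P.span_UN_subspaces[OF P.eval_in_span_pieces P.subspace_piece] by blast
  obtain h where h: "\<And>i. \<alpha> i h = 1" using principal_grading_element by blast
  have eig: "bracket (H h) (fst (y d)) = scale_g (of_int d) (fst (y d))" for d
    using P.piece_eigenvector[OF h y[of d]] by simp
  have "fst (sum y S) = eval t" by (simp add: x[symmetric] alg_eval_prod)
  then have sum_fst: "(\<Sum>d\<in>S. fst (y d)) \<in> {0}" by (simp add: fst_sum assms)
  \<comment> \<open>The components in \<open>g(A)\<close> sum to \<open>eval t = 0\<close> and have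
    distinct eigenvalues \<open>d\<close> under the grading element.\<close>
  have fst0: "fst (y d) = 0" if "d \<in> S" for d
  proof -
    have "fst (y d) \<in> {0}"
      by (rule eigencomponents_in_subspace[where S = S and D = "\<lambda>_::unit. bracket (H h)"
            and ev = "\<lambda>d _. of_int d" and x = "\<lambda>d. fst (y d)", OF _ _ linear_bracket S eig _ sum_fst that])
        auto
    then show ?thesis by simp
  qed
  have e_part: "T.homogeneous T.e n (snd z)" if "P.homogeneous P.e n z" for n z
    using that
    by (induction rule: P.homogeneous.induct) (auto intro: T.homogeneous.intros T.homogeneous_gen[unfolded One_nat_def])
  have f_part: "T.homogeneous T.f n (snd z)" if "P.homogeneous P.f n z" for n z
    using that
    by (induction rule: P.homogeneous.induct) (auto intro: T.homogeneous.intros T.homogeneous_gen[unfolded One_nat_def])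
  have "abelianize (app (snd (y d)) vacuum) c = 0" if d: "d \<in> S" for d
  proof -
    consider "d > 0" | "d = 0" | "d = -1" | "d \<le> -2" by linarith
    then show ?thesis
    proof cases
      case 1
      then have "T.homogeneous T.e (nat d) (snd (y d))"
        using y[of d] by (intro e_part) (simp add: P.piece_def)
      then show ?thesis using homogeneous_e_vacuum by (simp add: abelianize_zero)
    next
      case 2
      then obtain h' where h': "y d = P.H h'" using y[of d] by (auto simp: P.piece_def)
      then have "h' = 0" using fst0[OF d] by (intro H_eq_zero) simp
      then have "y d = 0" using h' P.h_zero by simp
      then show ?thesis by (simp add: abelianize_zero)
    next
      case 3
      then obtain a where a: "y d = (\<Sum>i\<in>UNIV. ?s (a i) (P.f i))"
        using y[of d] P.homogeneous_1[of P.f 1 "y d"] by (auto simp: P.piece_def)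
      have sum0: "(\<Sum>i\<in>UNIV. scale_g (a i) (f i)) = 0"
        using fst0[OF d] unfolding a by (simp add: fst_sum)
      \<comment> \<open>Applying \<open>e j\<close> isolates \<open>a j\<close> times a nonzero
        coroot, and \<open>H\<close> is injective: the \<open>f i\<close> stay independent in
        \<open>g(A)\<close>.\<close>
      have "a j = 0" for j
      proof -
        interpret ad: Vector_Spaces.linear scale_g scale_g "bracket (e j)" by (rule linear_bracket)
        have "0 = bracket (e j) (\<Sum>i\<in>UNIV. scale_g (a i) (f i))" by (simp add: sum0)
        also have "\<dots> = (\<Sum>i\<in>UNIV. if j = i then H (scale_h (a i) (\<alpha>v i)) else 0)"
          unfolding ad.sum by (rule sum.cong) (auto simp: ad.scale e_f h_scale)
        finally have "scale_h (a j) (\<alpha>v j) = 0" by (intro H_eq_zero) simp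
        then show "a j = 0" using coroot_nonzero by simp
      qed
      then have "y d = 0" unfolding a by (simp flip: zero_prod_def)
      then show ?thesis by (simp add: abelianize_zero)
    next
      case 4
      then have "T.homogeneous T.f (nat (- d)) (snd (y d))"
        using y[of d] by (intro f_part) (simp add: P.piece_def)
      then show ?thesis using abelianize_homogeneous_f 4 by simp
    qed
  qed
  moreover have "abelianize (app (sum g S) vacuum) c = (\<Sum>d\<in>S. abelianize (app (g d) vacuum) c)"
    for g :: "int \<Rightarrow> 'i list endo"
    using S
  proof induction
    case (insert d F)
    then show ?case unfolding sum.insert[OF insert.hyps] T.act_add_left abelianize_add by simp
  qed (simp only: sum.empty T.act_zero abelianize_zero)
  moreover have "\<rho> \<Lambda> t = (\<Sum>d\<in>S. snd (y d))"
  proof -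
    have "\<rho> \<Lambda> t = snd (P.eval t)" by (simp add: alg_eval_prod)
    then show ?thesis by (simp add: x snd_sum)
  qed
  ultimately show ?thesis by simp
qed

end

section \<open>From the word module of the auxiliary algebra to the Verma module\<close>

primrec word_term :: "(('i, 'h) km_gen \<Rightarrow> 'g) \<Rightarrow> 'i list \<Rightarrow> 'g env_gen alg_term" where
  "word_term gen [] = Gen Unit"
| "word_term gen (i # w) = Times (Gen (Elem (gen (Gen_f i)))) (word_term gen w)"

context kac_moody_weight
begin

text \<open>The submodule that has to be divided out of the word module for \<open>g(A)\<close> to
  act.\<close>

definition kernel_space :: "('i list \<Rightarrow> complex) set" where
  "kernel_space = T.words_span {app (\<rho> \<Lambda> t) vacuum | t. eval t = 0}"

text \<open>The submodule generated by the vacuum. Terms vanishing in \<open>g(A)\<close> are shown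
  to map it into \<open>kernel_space\<close>; nothing is claimed about other functions on
  words.\<close>

definition finite_space :: "('i list \<Rightarrow> complex) set" where
  "finite_space = T.words_span {vacuum}"

lemma subspace_kernel_space: "T.M.subspace kernel_space"
  and subspace_finite_space: "T.M.subspace finite_space"
  by (simp_all add: kernel_space_def finite_space_def T.words_span_def)

lemma vacuum_in_finite_space: "vacuum \<in> finite_space"
  using T.word_act_words_span[of vacuum "{vacuum}" "[]"] T.M.span_base[of vacuum "{vacuum}"]
  by (simp add: finite_space_def)

lemma finite_space_stable: "x \<in> finite_space \<Longrightarrow> app (\<rho> \<Lambda> t) x \<in> finite_space"
  unfolding finite_space_def
proof (erule T.words_span_stable[rotated 2])
  show "app (T.H h) s \<in> T.M.span {vacuum}" if "s \<in> {vacuum}" for h s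
    using that by (simp add: h_vacuum T.M.span_base T.M.span_scale)
  show "app (T.e i) s \<in> T.M.span {vacuum}" if "s \<in> {vacuum}" for i s
  proof -
    have "app (T.e i) s = 0" using that e_vacuum by simp
    then show ?thesis by (simp only: T.M.span_zero)
  qed
qed

lemma kernel_vacuum: "eval t = 0 \<Longrightarrow> app (\<rho> \<Lambda> t) vacuum \<in> T.M.span {app (\<rho> \<Lambda> t) vacuum | t. eval t = 0}"
  by (rule T.M.span_base) blast

lemma kernel_space_stable: "x \<in> kernel_space \<Longrightarrow> app (\<rho> \<Lambda> t) x \<in> kernel_space"
  unfolding kernel_space_def
proof (erule T.words_span_stable[rotated 2])
  let ?S = "{app (\<rho> \<Lambda> t) vacuum | t. eval t = 0}"
  \<comment> \<open>The bracket with \<open>t\<close> again vanishes in \<open>g(A)\<close>, and for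
    \<open>e i\<close> and \<open>H h\<close> the last term is zero or a multiple of the vector at
    hand.\<close>
  have comm: "app (word_gen \<alpha> \<alpha>v \<Lambda> g) (app (\<rho> \<Lambda> t) vacuum) =
      app (\<rho> \<Lambda> (Times (Gen g) t)) vacuum + app (\<rho> \<Lambda> t) (app (word_gen \<alpha> \<alpha>v \<Lambda> g) vacuum)" for g t
    using T.act_bracket[of "word_gen \<alpha> \<alpha>v \<Lambda> g" "\<rho> \<Lambda> t" vacuum] by simp
  fix s assume "s \<in> ?S"
  then obtain t where t: "s = app (\<rho> \<Lambda> t) vacuum" "eval t = 0" by blast
  have tg: "app (\<rho> \<Lambda> (Times (Gen g) t)) vacuum \<in> T.M.span ?S" for g
    by (rule kernel_vacuum) (simp add: t)
  show "app (T.H h) s \<in> T.M.span ?S" for h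
    unfolding t(1) comm h_vacuum T.act_scale_right
    by (intro T.M.span_add T.M.span_scale tg kernel_vacuum t)
  show "app (T.e i) s \<in> T.M.span ?S" for i
    unfolding t(1) comm e_vacuum T.act_zero(2) add_0_right by (rule tg)
qed

text \<open>Moving \<open>t\<close> past \<open>f i\<close> costs \<open>[t, f i]\<close>, another
  term that vanishes in \<open>g(A)\<close>; hence the induction on words runs over all such
  \<open>t\<close> at once.\<close>

lemma kernel_in_kernel_space:
  assumes "eval t = 0" and "x \<in> finite_space"
  shows "app (\<rho> \<Lambda> t) x \<in> kernel_space"
  using assms(2) unfolding finite_space_def T.words_span_def
proof (induction rule: T.M.span_induct_alt)
  case base
  show ?case unfolding T.act_zero(2) by (rule T.M.subspace_0[OF subspace_kernel_space])
next
  case (step c x y)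
  have "app (\<rho> \<Lambda> t) (T.word_act w vacuum) \<in> kernel_space" for w
    using assms(1)
  proof (induction w arbitrary: t)
    case Nil
    then show ?case
      using T.word_act_words_span[OF kernel_vacuum, of t "[]"] by (simp add: kernel_space_def)
  next
    case (Cons i w)
    let ?x = "T.word_act w vacuum"
    have "app (\<rho> \<Lambda> t) (T.word_act (i # w) vacuum) =
        app (\<rho> \<Lambda> (Gen (Gen_f i))) (app (\<rho> \<Lambda> t) ?x) + app (\<rho> \<Lambda> (Times t (Gen (Gen_f i)))) ?x"
      using T.act_bracket[of "\<rho> \<Lambda> t" "T.f i" ?x] by simp
    also have "\<dots> \<in> kernel_space"
      by (intro T.M.subspace_add[OF subspace_kernel_space] kernel_space_stable Cons.IH)
        (use Cons.prems in simp_all)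
    finally show ?case .
  qed
  then have "app (\<rho> \<Lambda> t) x \<in> kernel_space" using step.hyps by blast
  with step.IH show ?case unfolding T.act_add_right T.act_scale_right
    by (intro T.M.subspace_add[OF subspace_kernel_space] T.M.subspace_scale[OF subspace_kernel_space])
qed

lemma abelianize_kernel_space:
  assumes "x \<in> kernel_space"
  shows "abelianize x c = 0"
  using assms unfolding kernel_space_def T.words_span_def
proof (induction rule: T.M.span_induct_alt)
  case base
  show ?case by (rule abelianize_zero)
next
  case (step a x y)
  then obtain w t where x: "x = T.word_act w (app (\<rho> \<Lambda> t) vacuum)" and t: "eval t = 0" by blast
  have "abelianize (T.word_act w (app (\<rho> \<Lambda> t) vacuum)) c = 0" for w c
    by (induction w arbitrary: c) (simp_all add: abelianize_kernel[OF t] abelianize_f)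
  with step.IH show ?case unfolding x abelianize_add abelianize_scale by simp
qed

text \<open>
  The algebra acts on \<open>finite_space\<close> modulo \<open>kernel_space\<close>, through preimages of its elements.
\<close>

definition lift_act :: "'g \<Rightarrow> ('i list \<Rightarrow> complex) \<Rightarrow> 'i list \<Rightarrow> complex" where
  "lift_act x = app (\<rho> \<Lambda> (SOME t. eval t = x))"

abbreviation "env \<equiv> env_act scale_fun lift_act"

text \<open>Two preimages of \<open>x\<close> differ by a term that vanishes in \<open>g(A)\<close>,
  so the choice of preimage is immaterial modulo \<open>kernel_space\<close>.\<close>

lemma lift_act_congruent:
  assumes "eval t = x" and "v \<in> finite_space"
  shows "lift_act x v - app (\<rho> \<Lambda> t) v \<in> kernel_space"
proof -
  let ?t = "SOME t. eval t = x"
  have "eval ?t = x" using assms(1) by (rule someI)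
  then have "app (\<rho> \<Lambda> (Plus ?t (Scale (-1) t))) v \<in> kernel_space"
    using assms by (intro kernel_in_kernel_space) simp_all
  also have "app (\<rho> \<Lambda> (Plus ?t (Scale (-1) t))) v = lift_act x v - app (\<rho> \<Lambda> t) v"
    by (simp add: lift_act_def fun_eq_iff app_simps)
  finally show ?thesis .
qed

lemma lift_act_linear: "lift_act z (x + y) = lift_act z x + lift_act z y"
  "lift_act z (x - y) = lift_act z x - lift_act z y"
  "lift_act z (scale_fun a x) = scale_fun a (lift_act z x)"
  unfolding lift_act_def by (rule T.act_add_right app_diff T.act_scale_right)+

lemma env_add: "env u (x + y) = env u x + env u y"
proof (induction u arbitrary: x y)
  case (Gen g)
  show ?case by (cases g) (simp_all only: env_act.simps env_gen.case lift_act_linear)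
qed (simp_all only: env_act.simps add_0_left T.M.scale_right_distrib ac_simps)

lemma env_scale: "env u (scale_fun a x) = scale_fun a (env u x)"
proof (induction u arbitrary: x)
  case (Gen g)
  show ?case by (cases g) (simp_all only: env_act.simps env_gen.case lift_act_linear)
qed (simp_all only: env_act.simps T.M.scale_zero_right T.M.scale_right_distrib T.M.scale_scale
    mult.commute)

lemma env_diff: "env u (x - y) = env u x - env u y"
proof -
  have "env u (x - y) + env u y = env u x" by (simp only: env_add[symmetric] diff_add_cancel)
  then show ?thesis by (simp only: eq_diff_eq)
qed

lemmas env_linear = env_add env_diff env_scale

lemma env_finite_space: "x \<in> finite_space \<Longrightarrow> env u x \<in> finite_space"
proof (induction u arbitrary: x)
  case (Gen g)
  then show ?case by (cases g) (simp_all add: lift_act_def finite_space_stable)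
next
  case Zero
  show ?case unfolding env_act.simps by (rule T.M.subspace_0[OF subspace_finite_space])
qed (simp_all add: T.M.subspace_add[OF subspace_finite_space] T.M.subspace_scale[OF subspace_finite_space])

lemma env_kernel_space: "x \<in> kernel_space \<Longrightarrow> env u x \<in> kernel_space"
proof (induction u arbitrary: x)
  case (Gen g)
  then show ?case by (cases g) (simp_all add: lift_act_def kernel_space_stable)
next
  case Zero
  show ?case unfolding env_act.simps by (rule T.M.subspace_0[OF subspace_kernel_space])
qed (simp_all add: T.M.subspace_add[OF subspace_kernel_space] T.M.subspace_scale[OF subspace_kernel_space])

text \<open>The relations for sums, multiples and brackets hold only up to an error, since preimages
  are chosen separately for each element; the relations of associativity and unit hold
  exactly.\<close>

lemma env_relation_congruent:
  assumes "env_relation scale_g bracket s t" and x: "x \<in> finite_space"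
  shows "env s x - env t x \<in> kernel_space"
  using assms(1)
proof cases
  case (env_elem_add y z)
  obtain s' t' where st: "eval s' = y" "eval t' = z" using surj_eval by (metis surjD)
  have "(lift_act (y + z) x - app (\<rho> \<Lambda> (Plus s' t')) x) -
      ((lift_act y x - app (\<rho> \<Lambda> s') x) + (lift_act z x - app (\<rho> \<Lambda> t') x)) \<in> kernel_space"
    by (intro T.M.subspace_diff[OF subspace_kernel_space] T.M.subspace_add[OF subspace_kernel_space]
        lift_act_congruent x) (simp_all add: st)
  then show ?thesis by (simp add: env_elem_add T.act_add_left algebra_simps)
next
  case (env_elem_scale a y)
  obtain s' where st: "eval s' = y" using surj_eval by (metis surjD)
  have "(lift_act (scale_g a y) x - app (\<rho> \<Lambda> (Scale a s')) x) -
      scale_fun a (lift_act y x - app (\<rho> \<Lambda> s') x) \<in> kernel_space"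
    by (intro T.M.subspace_diff[OF subspace_kernel_space] T.M.subspace_scale[OF subspace_kernel_space]
        lift_act_congruent x) (simp_all add: st)
  then show ?thesis
    by (simp add: env_elem_scale T.act_scale_left T.M.scale_right_diff_distrib)
next
  case (env_elem_bracket y z)
  \<comment> \<open>The very preimages used by \<open>lift_act\<close>, so that
    \<open>Times ?s ?t\<close> acts literally as the commutator of the two lifted operators.\<close>
  let ?s = "SOME s. eval s = y" and ?t = "SOME t. eval t = z"
  have st: "eval ?s = y" "eval ?t = z" using surj_eval by (metis (mono_tags) surjD someI)+
  have "lift_act (bracket y z) x - app (\<rho> \<Lambda> (Times ?s ?t)) x \<in> kernel_space"
    by (rule lift_act_congruent) (simp_all add: st x)
  then show ?thesis
    by (simp add: env_elem_bracket T.act_bracket lift_act_def[of y] lift_act_def[of z])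
qed (simp_all add: T.M.subspace_0[OF subspace_kernel_space])

lemma env_congruent:
  assumes "alg_cong (env_relation scale_g bracket) s t" and "x \<in> finite_space"
  shows "env s x - env t x \<in> kernel_space"
  using assms
proof (induction arbitrary: x rule: alg_cong.induct)
  note W = subspace_kernel_space
  {
    case (ac_rel s t)
    then show ?case by (rule env_relation_congruent)
  next
    case (ac_sym s t)
    from T.M.subspace_neg[OF W ac_sym.IH[OF ac_sym.prems]] show ?case
      by (simp only: minus_diff_eq)
  next
    case (ac_trans s t u)
    from T.M.subspace_add[OF W ac_trans.IH(1)[OF ac_trans.prems] ac_trans.IH(2)[OF ac_trans.prems]]
    show ?case by (simp only: add_diff_eq diff_add_cancel)
  next
    case (ac_cong_Plus s s' t t')
    from T.M.subspace_add[OF W ac_cong_Plus.IH(1)[OF ac_cong_Plus.prems] ac_cong_Plus.IH(2)[OF ac_cong_Plus.prems]]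
    show ?case by (simp only: env_act.simps add_diff_add)
  next
    case (ac_cong_Scale s s' a)
    from T.M.subspace_scale[OF W ac_cong_Scale.IH[OF ac_cong_Scale.prems]]
    show ?case by (simp only: env_act.simps T.M.scale_right_diff_distrib)
  next
    case (ac_cong_Times s s' t t')
    \<comment> \<open>The first difference needs \<open>finite_space\<close> to be stable, the
      second needs \<open>kernel_space\<close> to be stable.\<close>
    have "(env s (env t x) - env s' (env t x)) + env s' (env t x - env t' x) \<in> kernel_space"
      by (intro T.M.subspace_add[OF W] env_kernel_space ac_cong_Times.IH env_finite_space
          ac_cong_Times.prems)
    then show ?case by (simp only: env_act.simps env_linear add_diff_eq diff_add_cancel)
  }
qed (simp_all add: env_linear T.M.scale_left_distrib T.M.scale_right_distrib algebra_simps
    T.M.subspace_0[OF subspace_kernel_space])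

text \<open>The elements with some preimage that kills the vacuum form a subalgebra containing the
  \<open>e i\<close>. One preimage is enough, as the choice matters only modulo
  \<open>kernel_space\<close>.\<close>

lemma n_plus_vacuum:
  assumes "x \<in> n_plus scale_g bracket gen"
  shows "\<exists>t. eval t = x \<and> app (\<rho> \<Lambda> t) vacuum = 0"
proof -
  let ?S = "{x. \<exists>t. eval t = x \<and> app (\<rho> \<Lambda> t) vacuum = 0}"
  have "n_plus scale_g bracket gen \<subseteq> ?S"
    unfolding n_plus_def
  proof (rule hull_minimal)
    show "range (\<lambda>i. gen (Gen_e i)) \<subseteq> ?S"
    proof
      fix x assume "x \<in> range (\<lambda>i. gen (Gen_e i))"
      then obtain i where "x = eval (Gen (Gen_e i))" by auto
      moreover have "app (\<rho> \<Lambda> (Gen (Gen_e i))) vacuum = 0" using e_vacuum by simp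
      ultimately show "x \<in> ?S" by blast
    qed
    have "eval Zero \<in> ?S" by (intro CollectI exI[of _ Zero]) (simp add: T.act_zero)
    moreover have "x + y \<in> ?S" if "x \<in> ?S" "y \<in> ?S" for x y
    proof -
      from that obtain s t
        where "eval s = x" "app (\<rho> \<Lambda> s) vacuum = 0" "eval t = y" "app (\<rho> \<Lambda> t) vacuum = 0"
        by (elim CollectE exE conjE) (rule that)
      then show ?thesis by (intro CollectI exI[of _ "Plus s t"]) (simp add: T.act_add_left)
    qed
    moreover have "scale_g a x \<in> ?S" if "x \<in> ?S" for a x
    proof -
      from that obtain s where "eval s = x" "app (\<rho> \<Lambda> s) vacuum = 0"
        by (elim CollectE exE conjE) (rule that)
      then show ?thesis
        by (intro CollectI exI[of _ "Scale a s"]) (simp add: T.act_scale_left fun_eq_iff scale_fun_def)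
    qed
    moreover have "bracket x y \<in> ?S" if "x \<in> ?S" "y \<in> ?S" for x y
    proof -
      from that obtain s t
        where st: "eval s = x" "app (\<rho> \<Lambda> s) vacuum = 0" "eval t = y" "app (\<rho> \<Lambda> t) vacuum = 0"
        by (elim CollectE exE conjE) (rule that)
      have "app (\<rho> \<Lambda> (Times s t)) vacuum = 0"
        unfolding alg_eval.simps T.act_bracket st T.act_zero by simp
      then show ?thesis using st by (intro CollectI exI[of _ "Times s t"]) simp
    qed
    ultimately show "lie_subalgebra scale_g bracket ?S"
      unfolding lie_subalgebra_def subspace_def alg_eval.simps(2) by blast
  qed
  then show ?thesis using assms by blast
qed

text \<open>In effect a homomorphism from \<open>M(\<Lambda>)\<close> to \<open>finite_space\<close>
  modulo \<open>kernel_space\<close> that sends the highest weight vector to the class of the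
  vacuum.\<close>

lemma verma_ideal_vacuum:
  assumes "u \<in> verma_ideal scale_g bracket gen \<Lambda>"
  shows "env u vacuum \<in> kernel_space"
  using assms
proof (induction rule: verma_ideal.induct)
  note W = subspace_kernel_space
  case verma_zero
  show ?case unfolding env_act.simps by (rule T.M.subspace_0[OF W])
next
  note W = subspace_kernel_space
  case (verma_cong s t)
  from T.M.subspace_diff[OF W verma_cong.IH env_congruent[OF verma_cong.hyps(2) vacuum_in_finite_space]]
  show ?case by simp
next
  case (verma_plus s t)
  show ?case unfolding env_act.simps
    by (rule T.M.subspace_add[OF subspace_kernel_space verma_plus.IH])
next
  case (verma_times t s)
  then show ?case by (simp add: env_kernel_space)
next
  case (verma_n_plus x)
  then obtain t where t: "eval t = x" "app (\<rho> \<Lambda> t) vacuum = 0" using n_plus_vacuum by blast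
  from lift_act_congruent[OF t(1) vacuum_in_finite_space] show ?case unfolding t(2) by simp
next
  case (verma_cartan h)
  have "lift_act (H h) vacuum - app (\<rho> \<Lambda> (Gen (Gen_h h))) vacuum \<in> kernel_space"
    by (rule lift_act_congruent) (simp_all add: vacuum_in_finite_space)
  then show ?case
    unfolding env_act.simps env_gen.case alg_eval.simps h_vacuum T.M.scale_minus_left
      add_uminus_conv_diff .
qed

text \<open>Modulo \<open>kernel_space\<close> the monomial acts on the vacuum as the word
  \<open>w\<close>, whose abelianization is a single monomial with coefficient 1, while
  abelianization vanishes on \<open>kernel_space\<close>.\<close>

lemma word_term_not_in_verma_ideal: "word_term gen w \<notin> verma_ideal scale_g bracket gen \<Lambda>"
proof
  assume "word_term gen w \<in> verma_ideal scale_g bracket gen \<Lambda>"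
  then have 0: "env (word_term gen w) vacuum \<in> kernel_space" by (rule verma_ideal_vacuum)
  have word: "T.word_act w vacuum \<in> finite_space" for w
    unfolding finite_space_def by (rule T.word_act_words_span) (simp add: T.M.span_base)
  have "env (word_term gen w) vacuum - T.word_act w vacuum \<in> kernel_space"
  proof (induction w)
    case Nil
    show ?case unfolding word_term.simps env_act.simps env_gen.case T.word_act_simps diff_self
      by (rule T.M.subspace_0[OF subspace_kernel_space])
  next
    case (Cons i w)
    let ?x = "env (word_term gen w) vacuum" and ?y = "T.word_act w vacuum"
    have "(lift_act (f i) ?y - app (\<rho> \<Lambda> (Gen (Gen_f i))) ?y) + env (Gen (Elem (f i))) (?x - ?y)
        \<in> kernel_space"
      by (intro T.M.subspace_add[OF subspace_kernel_space] lift_act_congruent env_kernel_space Cons word)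
        simp
    moreover have "(a - b) + (c - a) = c - b" for a b c :: "'i list \<Rightarrow> complex"
      by (simp add: fun_eq_iff)
    ultimately show ?case
      by (simp only: env_act.simps env_gen.case word_term.simps T.word_act_simps alg_eval.simps
          lift_act_linear)
  qed
  from abelianize_kernel_space[OF T.M.subspace_diff[OF subspace_kernel_space 0 this]]
  have "abelianize (T.word_act w vacuum) (mset w) = 0" by simp
  moreover have "abelianize (T.word_act w vacuum) (mset w) = 1"
  proof (induction w)
    case Nil
    have "{w :: 'i list. w = []} = {[]}" by auto
    then show ?case by (simp add: abelianize_def vacuum_def)
  qed (simp add: abelianize_f)
  ultimately show False by simp
qed

end

section \<open>Commuting lowering operators\<close>

lemma (in lie_algebra) lie_module_adjoint: "lie_module smul bracket smul bracket"
proof -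
  have "bracket (bracket x y) v = bracket x (bracket y v) - bracket y (bracket x v)" for x y v
    using bracket_derivation[of x y v] by simp
  then show ?thesis
    by unfold_locales (simp_all add: bracket_add_left bracket_add_right bracket_scale_left
        bracket_scale_right)
qed

lemma alg_cong_scale_zero: "alg_cong R (Scale 0 s) Zero"
proof -
  have "alg_cong R (Scale (1 + (-1)) s) (Plus (Scale 1 s) (Scale (-1) s))" by (rule ac_plus_scale)
  moreover have "alg_cong R (Plus (Scale 1 s) (Scale (-1) s)) (Plus s (Scale (-1) s))"
    by (intro ac_cong_Plus ac_scale_one ac_refl)
  moreover have "alg_cong R (Plus s (Scale (-1) s)) Zero" by (rule ac_plus_minus)
  ultimately have "alg_cong R (Scale (1 + (-1)) s) Zero" by (blast intro: ac_trans)
  then show ?thesis by simp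
qed

context kac_moody
begin

text \<open>For \<open>Gen_h h\<close> the coefficient is \<open>\<Lambda> h\<close>, so running
  over all \<open>\<Lambda>\<close> detects Cartan elements.\<close>

definition vacuum_free :: "('i, 'h) km_gen alg_term \<Rightarrow> bool" where
  "vacuum_free t \<longleftrightarrow> (\<forall>\<Lambda>. linear_functional scale_h \<Lambda> \<longrightarrow> app (\<rho> \<Lambda> t) vacuum [] = 0)"

lemma \<rho>_cong:
  assumes "linear_functional scale_h \<Lambda>"
    and "alg_cong (lie_relation (km_relation scale_h \<alpha> \<alpha>v)) s t"
  shows "\<rho> \<Lambda> s = \<rho> \<Lambda> t"
  by (rule chevalley.eval_alg_cong[OF chevalley_word[OF assms(1)] assms(2)])

text \<open>
  The largest ideal all of whose elements have no vacuum component avoids the Cartan subalgebra.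
\<close>

lemma eval_eq_zero_if_vacuum_free:
  assumes "\<And>ss. vacuum_free (foldr Times ss t)"
  shows "eval t = 0"
proof -
  let ?R = "lie_relation (km_relation scale_h \<alpha> \<alpha>v)"
  \<comment> \<open>Iterated brackets are built in, so closure under brackets is automatic.\<close>
  define I where "I = {t. \<forall>ss. vacuum_free (foldr Times ss t)}"
  interpret E: lie_algebra scale_endo "commutator :: 'i list endo \<Rightarrow> _" by (rule lie_algebra_endo)
  have cong: "alg_cong ?R (foldr Times ss s) (foldr Times ss t)" if "alg_cong ?R s t" for ss s t
    by (induction ss) (simp_all add: that ac_cong_Times ac_refl)
  have fold_plus: "\<rho> \<Lambda> (foldr Times ss (Plus s t)) = \<rho> \<Lambda> (foldr Times ss s) + \<rho> \<Lambda> (foldr Times ss t)"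
    and fold_scale: "\<rho> \<Lambda> (foldr Times ss (Scale a s)) = scale_endo a (\<rho> \<Lambda> (foldr Times ss s))"
    and fold_zero: "\<rho> \<Lambda> (foldr Times ss Zero) = 0" for ss s t \<Lambda> a
    by (induction ss) (simp_all add: E.bracket_add_right E.bracket_scale_right)
  have "cartan_avoiding_ideal scale_h \<alpha> \<alpha>v I"
    unfolding cartan_avoiding_ideal_def presented_lie_ideal_def
  proof (intro conjI allI ballI impI)
    show "Zero \<in> I" by (simp add: I_def vacuum_free_def fold_zero app_simps)
    show "Plus s t \<in> I" if "s \<in> I" "t \<in> I" for s t
      using that by (simp add: I_def vacuum_free_def fold_plus app_simps)
    show "Scale a s \<in> I" if "s \<in> I" for a s
      using that by (simp add: I_def vacuum_free_def fold_scale app_simps)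
    show "Times s t \<in> I" if "t \<in> I" for s t
      unfolding I_def
    proof (intro CollectI allI)
      fix ss
      have "vacuum_free (foldr Times (ss @ [s]) t)" using that by (simp add: I_def del: foldr_append)
      then show "vacuum_free (foldr Times ss (Times s t))" by simp
    qed
    show "t \<in> I" if "s \<in> I" "alg_cong ?R s t" for s t
      using that(1) \<rho>_cong[OF _ cong[OF that(2)]] by (simp add: I_def vacuum_free_def)
    fix h assume h: "Gen (Gen_h h) \<in> I"
    have "\<Lambda> h = 0" if "linear_functional scale_h \<Lambda>" for \<Lambda>
    proof -
      have "vacuum_free (foldr Times [] (Gen (Gen_h h)))" using h unfolding I_def by blast
      then have "app (\<rho> \<Lambda> (Gen (Gen_h h))) vacuum [] = 0" using that by (simp add: vacuum_free_def)
      then show ?thesis by (simp add: word_gen_simps vacuum_def)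
    qed
    then have "h = 0" by (rule cartan_eq_zero_if_functionals)
    \<comment> \<open>The generator attached to the zero vector is a symbol distinct from
      \<open>Zero\<close>; linearity of the generators identifies the two.\<close>
    moreover have "alg_cong ?R (Gen (Gen_h (scale_h 0 0))) (Scale 0 (Gen (Gen_h 0)))"
      by (intro ac_rel lr_rel km_h_scale)
    ultimately show "alg_cong ?R (Gen (Gen_h h)) Zero"
      using ac_trans[OF _ alg_cong_scale_zero] by simp
  qed
  then have "I \<subseteq> {t. eval t = 0}" using km by (simp add: kac_moody_algebra_def Let_def)
  moreover have "t \<in> I" using assms by (simp add: I_def)
  ultimately show ?thesis by blast
qed

text \<open>Every \<open>e k\<close> kills \<open>[f i, f j]\<close> when both Cartan entries
  vanish. So the ideal it generates arises by bracketing with the \<open>f k\<close> alone and never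
  produces a vacuum component; maximality puts it into the kernel.\<close>

lemma f_commute:
  assumes "i \<noteq> j" and "\<alpha> i (\<alpha>v j) = 0" and "\<alpha> j (\<alpha>v i) = 0"
  shows "bracket (f i) (f j) = 0"
proof -
  have "eval (Times (Gen (Gen_f i)) (Gen (Gen_f j))) = 0"
  proof (rule eval_eq_zero_if_vacuum_free)
    fix ss
    let ?t = "Times (Gen (Gen_f i)) (Gen (Gen_f j)) :: ('i, 'h) km_gen alg_term"
    show "vacuum_free (foldr Times ss ?t)"
      unfolding vacuum_free_def
    proof (intro allI impI)
      fix \<Lambda> assume \<Lambda>: "linear_functional scale_h \<Lambda>"
      interpret Ad: chevalley_module scale_endo commutator scale_h \<alpha> \<alpha>v "word_gen \<alpha> \<alpha>v \<Lambda>"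
          scale_endo commutator
        by (intro chevalley_module.intro chevalley_word \<Lambda> lie_algebra.lie_module_adjoint
            lie_algebra_endo)
      let ?y = "commutator (Ad.f i) (Ad.f j)"
      have Hy: "commutator (Ad.H h) s \<in> Ad.span {?y}" if "s \<in> {?y}" for h s
      proof -
        have "commutator (Ad.H h) ?y = scale_endo (- \<alpha> i h - \<alpha> j h) ?y"
          by (simp add: Ad.bracket_derivation[of "Ad.H h"] Ad.h_f Ad.bracket_scale_left
              Ad.bracket_scale_right Ad.scale_left_diff_distrib)
        then show ?thesis using that by (simp add: Ad.span_base Ad.span_scale)
      qed
      have Ey: "commutator (Ad.e k) s \<in> Ad.span {?y}" if "s \<in> {?y}" for k s
      proof -
        have "commutator (Ad.f i) (Ad.H (\<alpha>v j)) = 0"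
          using Ad.bracket_antisym[of "Ad.f i" "Ad.H (\<alpha>v j)"] assms(2) by (simp add: Ad.h_f)
        then have "commutator (Ad.e k) ?y = 0"
          using assms by (simp add: Ad.bracket_derivation[of "Ad.e k"] Ad.e_f Ad.h_f)
        then show ?thesis using that by (simp add: Ad.span_zero)
      qed
      have "\<rho> \<Lambda> (foldr Times ss ?t) \<in> Ad.words_span {?y}"
      proof (induction ss)
        case Nil
        show ?case using Ad.word_act_words_span[of ?y "{?y}" "[]"] Ad.span_base[of ?y "{?y}"]
          by simp
      next
        case (Cons s ss)
        from Ad.words_span_stable[OF Hy Ey this, of s] show ?case by simp
      qed
      moreover have "app B \<phi> [] = 0" if "B \<in> Ad.words_span {?y}" for B \<phi>
        using that unfolding Ad.words_span_def
      proof (induction arbitrary: \<phi> rule: Ad.span_induct_alt)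
        case (step c x y)
        then obtain w where x: "x = Ad.word_act w ?y" by blast
        \<comment> \<open>Needed for all \<open>\<phi>\<close>, since one half of a commutator with
          \<open>f k\<close> first applies \<open>f k\<close> to \<open>\<phi>\<close>.\<close>
        have "app (Ad.word_act w ?y) \<phi> [] = 0" for w \<phi>
          by (induction w arbitrary: \<phi>) (simp_all add: commutator_def app_simps word_gen_simps)
        then show ?case using step.IH by (simp add: x app_simps)
      qed (simp add: app_simps)
      ultimately show "app (\<rho> \<Lambda> (foldr Times ss ?t)) vacuum [] = 0" by blast
    qed
  qed
  then show ?thesis by simp
qed

lemma word_weight_inject:
  assumes "\<And>h. word_weight \<alpha> u h = word_weight \<alpha> w h"
  shows "mset u = mset w"
proof -
  have "(\<Sum>i\<in>UNIV. (of_nat (count_list u i) - of_nat (count_list w i)) * \<alpha> i h) = 0" for h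
    using assms[of h] by (simp add: word_weight_count_list left_diff_distrib sum_subtractf)
  from roots_independent[OF this] have "count_list u i = count_list w i" for i
    by (simp add: of_nat_eq_iff)
  then show ?thesis by (simp add: multiset_eq_iff count_mset)
qed

lemma root_supp_word: "root_supp \<alpha> (word_weight \<alpha> w) = set w"
proof -
  have "c i = of_nat (count_list w i)" if "\<forall>h. word_weight \<alpha> w h = (\<Sum>j\<in>UNIV. c j * \<alpha> j h)" for c i
  proof -
    have "(\<Sum>j\<in>UNIV. (c j - of_nat (count_list w j)) * \<alpha> j h) = 0" for h
      using that by (simp add: word_weight_count_list left_diff_distrib sum_subtractf)
    from roots_independent[OF this] show ?thesis by simp
  qed
  then have "count_list w i \<noteq> 0" if "i \<in> root_supp \<alpha> (word_weight \<alpha> w)" for i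
    using that unfolding root_supp_def by fastforce
  moreover have "i \<in> root_supp \<alpha> (word_weight \<alpha> w)" if "count_list w i \<noteq> 0" for i
    unfolding root_supp_def
    by (intro CollectI exI[of _ "\<lambda>j. of_nat (count_list w j)"])
      (use that in \<open>simp add: word_weight_count_list\<close>)
  ultimately show ?thesis using count_list_0_iff[of w] by blast
qed

end

section \<open>Weights of highest weight modules\<close>

locale highest_weight_module = chevalley_module smul bracket scale_h \<alpha> \<alpha>v gen scale_M act
  for smul :: "complex \<Rightarrow> 'g :: ab_group_add \<Rightarrow> 'g" and bracket
    and scale_h :: "complex \<Rightarrow> 'h :: ab_group_add \<Rightarrow> 'h"
    and \<alpha> :: "'i :: finite \<Rightarrow> 'h \<Rightarrow> complex" and \<alpha>v :: "'i \<Rightarrow> 'h"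
    and gen :: "('i, 'h) km_gen \<Rightarrow> 'g"
    and scale_M :: "complex \<Rightarrow> 'm :: ab_group_add \<Rightarrow> 'm" and act +
  fixes \<Lambda> :: "'h \<Rightarrow> complex" and m :: 'm
  assumes e_highest: "act (e i) m = 0"
    and h_highest: "weight_vector \<Lambda> m"
    and generated: "words_span {m} = UNIV"
begin

definition component :: "('h \<Rightarrow> complex) \<Rightarrow> 'm set" where
  "component \<nu> = M.span {word_act w m | w. \<nu> = (\<lambda>h. \<Lambda> h - word_weight \<alpha> w h)}"

lemma subspace_component: "M.subspace (component \<nu>)"
  by (simp add: component_def)

lemma subspace_weight_vector: "M.subspace {x. weight_vector \<nu> x}"
  by (auto simp: M.subspace_def weight_vector_def act_add_right act_scale_right
      M.scale_right_distrib mult.commute)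

lemma weight_vector_component: "x \<in> component \<nu> \<Longrightarrow> weight_vector \<nu> x"
  using M.span_minimal[OF _ subspace_weight_vector, of "{word_act w m | w. \<nu> = (\<lambda>h. \<Lambda> h - word_weight \<alpha> w h)}" \<nu>]
    weight_vector_word_act[OF h_highest]
  unfolding component_def by blast

lemma span_components: "M.span (\<Union>\<nu>. component \<nu>) = UNIV"
proof -
  have "word_act w m \<in> (\<Union>\<nu>. component \<nu>)" for w
    unfolding component_def by (blast intro: M.span_base)
  then have "(\<Union>w. word_act w ` {m}) \<subseteq> (\<Union>\<nu>. component \<nu>)" by blast
  from M.span_mono[OF this] generated show ?thesis by (auto simp: words_span_def)
qed

lemma in_component: "weight_vector \<mu> x \<Longrightarrow> x \<in> component \<mu>"
  by (rule weight_vector_in_component[OF subspace_component weight_vector_component])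
    (simp_all add: span_components)

lemma weight_is_word_weight:
  assumes "weight_vector \<mu> x" and "x \<noteq> 0"
  obtains w where "\<mu> = (\<lambda>h. \<Lambda> h - word_weight \<alpha> w h)"
proof -
  have "{word_act w m | w. \<mu> = (\<lambda>h. \<Lambda> h - word_weight \<alpha> w h)} \<noteq> {}"
  proof
    assume empty: "{word_act w m | w. \<mu> = (\<lambda>h. \<Lambda> h - word_weight \<alpha> w h)} = {}"
    have "x \<in> M.span {}" using in_component[OF assms(1)] unfolding component_def empty .
    then show False using assms(2) by simp
  qed
  then show thesis using that by blast
qed

lemma submodule_spanned_by_weight_vectors:
  assumes "lie_submodule scale_M act N" and "x \<in> N"
  shows "x \<in> M.span {y \<in> N. \<exists>\<nu>. weight_vector \<nu> y}"
  using assms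
  by (intro submodule_weight_components[OF subspace_component weight_vector_component span_components])
    (simp_all add: lie_submodule_def)

lemma weights_iff: "\<mu> \<in> weights scale_h gen scale_M act N \<longleftrightarrow>
    linear_functional scale_h \<mu> \<and> (\<exists>x\<in>N. x \<noteq> 0 \<and> weight_vector \<mu> x)"
  by (simp add: weights_def weight_vector_def)

abbreviation edge_weights :: "'m set \<Rightarrow> bool" where
  "edge_weights N \<equiv> \<forall>\<mu>\<in>weights scale_h gen scale_M act N.
     has_dynkin_edge \<alpha> \<alpha>v (root_supp \<alpha> (\<lambda>h. \<Lambda> h - \<mu> h))"

text \<open>\<open>GREATEST\<close> is meaningful only once a greatest element is exhibited: the
  span of the union of all admissible submodules. The point is that a weight of the span is a weight
  of one of them.\<close>

lemma subset_max_edge_submodule_iff: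
  assumes m: "m \<noteq> 0" and \<Lambda>: "linear_functional scale_h \<Lambda>"
    and no_edge: "\<not> has_dynkin_edge \<alpha> \<alpha>v (root_supp \<alpha> (\<lambda>h. \<Lambda> h - \<Lambda> h))"
    and N: "lie_submodule scale_M act N" "N \<noteq> UNIV"
  shows "N \<subseteq> max_edge_submodule scale_h \<alpha> \<alpha>v gen \<Lambda> scale_M act \<longleftrightarrow> edge_weights N"
proof -
  let ?P = "\<lambda>N. lie_submodule scale_M act N \<and> N \<noteq> UNIV \<and> edge_weights N"
  define U where "U = \<Union> {N. ?P N}"
  have sub: "lie_submodule scale_M act (M.span U)"
    unfolding lie_submodule_def
  proof (intro conjI allI ballI)
    fix x v assume "v \<in> M.span U"
    then show "act x v \<in> M.span U"
    proof (rule act_in_span)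
      fix s assume "s \<in> U"
      then obtain N where "?P N" "s \<in> N" unfolding U_def by blast
      moreover from this have "act x s \<in> N" unfolding lie_submodule_def by blast
      ultimately have "act x s \<in> U" unfolding U_def by blast
      then show "act x s \<in> M.span U" by (rule M.span_base)
    qed
  qed simp
  have edge: "edge_weights (M.span U)"
  proof
    fix \<mu> assume "\<mu> \<in> weights scale_h gen scale_M act (M.span U)"
    then obtain v where lin: "linear_functional scale_h \<mu>" and v: "v \<in> M.span U" "v \<noteq> 0"
      and wt: "weight_vector \<mu> v" unfolding weights_iff by blast
    \<comment> \<open>Weight spaces rebuilt from elements of \<open>U\<close> alone, so that a
      weight vector of the span can be traced back to an actual element of \<open>U\<close>.\<close>
    define K where "K \<nu> = M.span {x \<in> U. weight_vector \<nu> x}" for \<nu>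
    have "U \<subseteq> M.span (\<Union>\<nu>. K \<nu>)"
    proof
      fix x assume "x \<in> U"
      then obtain N where N: "?P N" "x \<in> N" unfolding U_def by blast
      then have "x \<in> M.span {y \<in> N. \<exists>\<nu>. weight_vector \<nu> y}"
        by (intro submodule_spanned_by_weight_vectors) blast+
      moreover have "{y \<in> N. \<exists>\<nu>. weight_vector \<nu> y} \<subseteq> (\<Union>\<nu>. K \<nu>)"
      proof
        fix y assume y: "y \<in> {y \<in> N. \<exists>\<nu>. weight_vector \<nu> y}"
        then obtain \<nu> where "weight_vector \<nu> y" by blast
        moreover have "y \<in> U" using y N(1) unfolding U_def by blast
        ultimately have "y \<in> K \<nu>" unfolding K_def by (intro M.span_base) simp
        then show "y \<in> (\<Union>\<nu>. K \<nu>)" by blast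
      qed
      ultimately show "x \<in> M.span (\<Union>\<nu>. K \<nu>)" by (rule subsetD[OF M.span_mono, rotated])
    qed
    then have inK: "v \<in> M.span (\<Union>\<nu>. K \<nu>)"
      using subsetD[OF M.span_minimal[OF _ M.subspace_span] v(1)] by simp
    have subK: "M.subspace (K \<nu>)" for \<nu> by (simp add: K_def)
    have "K \<nu> \<subseteq> {x. weight_vector \<nu> x}" for \<nu>
      unfolding K_def by (rule M.span_minimal[OF _ subspace_weight_vector]) auto
    then have wtK: "weight_vector \<nu> x" if "x \<in> K \<nu>" for \<nu> x using that by auto
    have vK: "v \<in> K \<mu>" by (rule weight_vector_in_component[OF subK wtK inK wt])
    have "\<not> {x \<in> U. weight_vector \<mu> x} \<subseteq> {0}"
    proof
      assume "{x \<in> U. weight_vector \<mu> x} \<subseteq> {0}"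
      from M.span_minimal[OF this M.subspace_single_0] show False using vK v(2) by (auto simp: K_def)
    qed
    then obtain x where x: "x \<in> U" "weight_vector \<mu> x" "x \<noteq> 0" by auto
    then obtain N where N: "?P N" "x \<in> N" unfolding U_def by auto
    have "\<mu> \<in> weights scale_h gen scale_M act N" unfolding weights_iff using lin x N(2) by blast
    then show "has_dynkin_edge \<alpha> \<alpha>v (root_supp \<alpha> (\<lambda>h. \<Lambda> h - \<mu> h))" using N(1) by blast
  qed
  \<comment> \<open>Otherwise \<open>m\<close> would give the weight \<open>\<Lambda>\<close>, which
    has no edge.\<close>
  have "M.span U \<noteq> UNIV"
  proof
    assume "M.span U = UNIV"
    then have "\<Lambda> \<in> weights scale_h gen scale_M act (M.span U)"
      using m h_highest \<Lambda> by (auto simp: weights_iff)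
    then show False using edge no_edge by blast
  qed
  with sub edge have P: "?P (M.span U)" by blast
  have top: "L \<le> M.span U" if "?P L" for L
  proof -
    have "L \<subseteq> U" using that unfolding U_def by auto
    then show ?thesis using M.span_superset[of U] by simp
  qed
  have "max_edge_submodule scale_h \<alpha> \<alpha>v gen \<Lambda> scale_M act = M.span U"
    unfolding max_edge_submodule_def by (rule Greatest_equality[of ?P, OF P top])
  moreover have "edge_weights N" if "N \<subseteq> M.span U"
  proof
    fix \<mu> assume "\<mu> \<in> weights scale_h gen scale_M act N"
    then have "\<mu> \<in> weights scale_h gen scale_M act (M.span U)" using that unfolding weights_iff by blast
    then show "has_dynkin_edge \<alpha> \<alpha>v (root_supp \<alpha> (\<lambda>h. \<Lambda> h - \<mu> h))" using edge by blast
  qed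
  moreover have "N \<subseteq> M.span U" if "edge_weights N" by (rule top) (use N that in simp)
  ultimately show ?thesis by auto
qed

end

context highest_weight_module
begin

lemma env_act_word_term: "env_act scale_M act (word_term gen w) x = word_act w x"
  by (induction w) simp_all

end

text \<open>The annihilator of \<open>m\<close> is passed on because it decides which words act on
  \<open>m\<close> by zero.\<close>

lemma verma_module_highest_weight:
  assumes "kac_moody_weight A scale_h \<alpha> \<alpha>v scale_g bracket gen \<Lambda>"
    and "verma_module scale_g bracket gen \<Lambda> scale_M act"
  obtains m where "highest_weight_module scale_g bracket scale_h \<alpha> \<alpha>v gen scale_M act \<Lambda> m"
    and "{u. env_act scale_M act u m = 0} = verma_ideal scale_g bracket gen \<Lambda>"
proof -
  interpret kac_moody_weight A scale_h \<alpha> \<alpha>v scale_g bracket gen \<Lambda> by fact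
  obtain m where surj: "surj (\<lambda>u. env_act scale_M act u m)"
    and ann: "{u. env_act scale_M act u m = 0} = verma_ideal scale_g bracket gen \<Lambda>"
    and lie_module: "lie_module scale_g bracket scale_M act"
    using assms(2) unfolding verma_module_def by blast
  interpret N: chevalley_module scale_g bracket scale_h \<alpha> \<alpha>v gen scale_M act
    by (intro chevalley_module.intro lie_module chevalley_axioms)
  have zero: "env_act scale_M act u m = 0" if "u \<in> verma_ideal scale_g bracket gen \<Lambda>" for u
    using that ann by auto
  have e: "act (e i) m = 0" for i
  proof -
    have "e i \<in> n_plus scale_g bracket gen" unfolding n_plus_def by (rule hull_inc) simp
    from zero[OF verma_n_plus[OF this]] show ?thesis by simp
  qed
  have h: "act (H h) m = scale_M (\<Lambda> h) m" for h
    using zero[OF verma_cartan[of gen h \<Lambda>]] by simp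
  have ws: "N.M.subspace (N.words_span {m})" by (simp add: N.words_span_def)
  have stable: "act x v \<in> N.words_span {m}" if v: "v \<in> N.words_span {m}" for x v
  proof -
    obtain t where t: "eval t = x" using surj_eval by (metis surjD)
    have "act (eval t) v \<in> N.words_span {m}"
      by (rule N.words_span_stable[OF _ _ v]) (simp_all add: e h N.M.span_zero N.M.span_scale N.M.span_base)
    then show ?thesis by (simp add: t)
  qed
  have m: "m \<in> N.words_span {m}"
    using N.word_act_words_span[of m "{m}" "[]"] by (simp add: N.M.span_base)
  have env: "env_act scale_M act u v \<in> N.words_span {m}" if "v \<in> N.words_span {m}" for u v
    using that
  proof (induction u arbitrary: v)
    case (Gen x)
    then show ?case by (cases x) (simp_all add: stable)
  qed (simp_all add: N.M.subspace_0[OF ws] N.M.subspace_add[OF ws] N.M.subspace_scale[OF ws])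
  have "N.words_span {m} = UNIV"
  proof (rule UNIV_eq_I[symmetric])
    fix v
    obtain u where "v = env_act scale_M act u m" using surj by (metis surjD)
    then show "v \<in> N.words_span {m}" using env[OF m] by simp
  qed
  then have "highest_weight_module scale_g bracket scale_h \<alpha> \<alpha>v gen scale_M act \<Lambda> m"
    by unfold_locales (simp_all add: e h N.weight_vector_def)
  then show thesis using ann by (rule that)
qed

theorem proposition2p7:
  fixes A :: "int ^ 'i ^ 'i"
    and scale_h :: "complex \<Rightarrow> 'h :: ab_group_add \<Rightarrow> 'h"
    and \<alpha> :: "'i \<Rightarrow> 'h \<Rightarrow> complex"
    and \<alpha>v :: "'i \<Rightarrow> 'h"
    and scale_g :: "complex \<Rightarrow> 'g :: ab_group_add \<Rightarrow> 'g"
    and bracket :: "'g \<Rightarrow> 'g \<Rightarrow> 'g"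
    and gen :: "('i, 'h) km_gen \<Rightarrow> 'g"
    and \<Lambda> :: "'h \<Rightarrow> complex"
    and scale_M :: "complex \<Rightarrow> 'm :: ab_group_add \<Rightarrow> 'm"
    and act_M :: "'g \<Rightarrow> 'm \<Rightarrow> 'm"
    and scale_V :: "complex \<Rightarrow> 'v :: ab_group_add \<Rightarrow> 'v"
    and act_V :: "'g \<Rightarrow> 'v \<Rightarrow> 'v"
    and p :: "'m \<Rightarrow> 'v"
    and N_V :: "'m set"
  assumes "generalized_cartan_matrix A"
    and "realization A scale_h \<alpha> \<alpha>v"
    and "kac_moody_algebra scale_h \<alpha> \<alpha>v scale_g bracket gen"
    and "linear_functional scale_h \<Lambda>"
    and "verma_module scale_g bracket gen \<Lambda> scale_M act_M"
    and "lie_submodule scale_M act_M N_V" and "N_V \<noteq> UNIV"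
    and "lie_module scale_g bracket scale_V act_V"
    and "lie_module_hom scale_M act_M scale_V act_V p"
    and "surj p" and "{v. p v = 0} = N_V"
  shows "weights scale_h gen scale_V act_V UNIV = weights scale_h gen scale_M act_M UNIV \<longleftrightarrow>
         N_V \<subseteq> max_edge_submodule scale_h \<alpha> \<alpha>v gen \<Lambda> scale_M act_M"
proof -
  interpret kac_moody_weight A scale_h \<alpha> \<alpha>v scale_g bracket gen \<Lambda>
    by (intro kac_moody_weight.intro kac_moody.intro kac_moody_weight_axioms.intro assms)
  obtain m where hw: "highest_weight_module scale_g bracket scale_h \<alpha> \<alpha>v gen scale_M act_M \<Lambda> m"
    and ann: "{u. env_act scale_M act_M u m = 0} = verma_ideal scale_g bracket gen \<Lambda>"
    by (rule verma_module_highest_weight[OF kac_moody_weight_axioms assms(5)])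
  interpret N: highest_weight_module scale_g bracket scale_h \<alpha> \<alpha>v gen scale_M act_M \<Lambda> m
    by (rule hw)
  interpret V: chevalley_module scale_g bracket scale_h \<alpha> \<alpha>v gen scale_V act_V
    by (intro chevalley_module.intro assms(8) chevalley_axioms)
  interpret p: Vector_Spaces.linear scale_M scale_V p
    using assms(9) by (simp add: lie_module_hom_def)
  have p_act: "p (act_M x v) = act_V x (p v)" for x v
    using assms(9) by (simp add: lie_module_hom_def)
  have p_word: "p (N.word_act w v) = V.word_act w (p v)" for w v
    by (induction w) (simp_all add: p_act)
  have ker: "p v = 0 \<longleftrightarrow> v \<in> N_V" for v using assms(11) by auto
  have "V.words_span {p m} = UNIV"
  proof (rule UNIV_eq_I[symmetric])
    fix v
    obtain x where x: "v = p x" using assms(10) by (metis surjD)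
    have "x \<in> N.words_span {m}" by (simp add: N.generated)
    then have "p x \<in> V.words_span {p m}" unfolding N.words_span_def
    proof (induction rule: N.M.span_induct_alt)
      case base
      show ?case by (simp add: V.words_span_def V.M.span_zero)
    next
      case (step c x y)
      then obtain w where "x = N.word_act w m" by blast
      then have "p x \<in> V.words_span {p m}"
        using V.word_act_words_span[of "p m" "{p m}" w] by (simp add: p_word V.M.span_base)
      with step.IH show ?case unfolding V.words_span_def p.add p.scale
        by (intro V.M.span_add V.M.span_scale)
    qed
    then show "v \<in> V.words_span {p m}" by (simp add: x)
  qed
  moreover have "act_V (e i) (p m) = 0" for i by (simp add: p_act[symmetric] N.e_highest)
  moreover have "V.weight_vector \<Lambda> (p m)"
    using N.h_highest by (simp add: V.weight_vector_def N.weight_vector_def p_act[symmetric] p.scale)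
  ultimately interpret V: highest_weight_module scale_g bracket scale_h \<alpha> \<alpha>v gen scale_V act_V \<Lambda> "p m"
    by unfold_locales

  have word_nonzero: "N.word_act w m \<noteq> 0" for w
  proof
    assume "N.word_act w m = 0"
    then have "word_term gen w \<in> verma_ideal scale_g bracket gen \<Lambda>"
      using ann N.env_act_word_term by auto
    then show False using word_term_not_in_verma_ideal by blast
  qed
  have word_wt: "N.weight_vector (\<lambda>h. \<Lambda> h - word_weight \<alpha> w h) (N.word_act w m)" for w
    by (rule N.weight_vector_word_act[OF N.h_highest])
  have lin: "linear_functional scale_h (\<lambda>h. \<Lambda> h - word_weight \<alpha> w h)" for w
    using assms(4) linear_root
    by (induction w) (simp_all add: linear_functional_iff[OF Cartan.vector_space_axioms] algebra_simps)
  have supp: "root_supp \<alpha> (\<lambda>h. \<Lambda> h - (\<Lambda> h - word_weight \<alpha> w h)) = set w" for w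
    using root_supp_word[of w] by (simp cong: if_cong)
  have sub: "N.M.subspace N_V" "act_M x v \<in> N_V" if "v \<in> N_V" for x v
    using assms(6) that by (auto simp: lie_submodule_def)

  have "N_V \<subseteq> max_edge_submodule scale_h \<alpha> \<alpha>v gen \<Lambda> scale_M act_M \<longleftrightarrow> N.edge_weights N_V"
  proof (rule N.subset_max_edge_submodule_iff[OF _ assms(4) _ assms(6,7)])
    show "m \<noteq> 0" using word_nonzero[of "[]"] by simp
    show "\<not> has_dynkin_edge \<alpha> \<alpha>v (root_supp \<alpha> (\<lambda>h. \<Lambda> h - \<Lambda> h))"
      using supp[of "[]"] by (simp add: has_dynkin_edge_def)
  qed
  moreover have "weights scale_h gen scale_V act_V UNIV = weights scale_h gen scale_M act_M UNIV"
    if edge: "N.edge_weights N_V"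
  proof (intro equalityI subsetI)
    fix \<mu> assume "\<mu> \<in> weights scale_h gen scale_V act_V UNIV"
    then obtain v where "v \<noteq> 0" "V.weight_vector \<mu> v" unfolding V.weights_iff by auto
    then obtain w where \<mu>: "\<mu> = (\<lambda>h. \<Lambda> h - word_weight \<alpha> w h)" using V.weight_is_word_weight by blast
    show "\<mu> \<in> weights scale_h gen scale_M act_M UNIV"
      unfolding N.weights_iff \<mu> using lin word_nonzero word_wt by blast
  next
    fix \<mu> assume "\<mu> \<in> weights scale_h gen scale_M act_M UNIV"
    then obtain v where "v \<noteq> 0" "N.weight_vector \<mu> v" unfolding N.weights_iff by auto
    then obtain w where \<mu>: "\<mu> = (\<lambda>h. \<Lambda> h - word_weight \<alpha> w h)" using N.weight_is_word_weight by blast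
    have zero: "0 \<in> N_V" using ker[of 0] by simp
    have "\<exists>u. count_list u = count_list w \<and> N.word_act u m \<notin> N_V"
    proof (rule N.exists_word_outside_submodule[where N = N_V and c = "count_list w",
          OF sub(1)[OF zero] sub(2) N.e_highest N.h_highest])
      show "\<alpha> i (\<alpha>v i) = 2" for i
        using gcm by (simp add: root_coroot generalized_cartan_matrix_def)
      show "\<exists>n::nat. \<alpha> j (\<alpha>v i) = - of_nat n" if "i \<noteq> j" for i j
      proof -
        have "A $ i $ j \<le> 0" using gcm that by (simp add: generalized_cartan_matrix_def)
        then have "\<alpha> j (\<alpha>v i) = - of_nat (nat (- A $ i $ j))" by (simp add: root_coroot)
        then show ?thesis by blast
      qed
      show "\<alpha> i (\<alpha>v j) = 0" if "\<alpha> j (\<alpha>v i) = 0" for i j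
        using gcm that by (simp add: root_coroot generalized_cartan_matrix_def)
      \<comment> \<open>Such a word is nonzero, so inside \<open>N_V\<close> it would give a weight
        of \<open>N_V\<close> without an edge.\<close>
      show "N.word_act u m \<notin> N_V" if "\<not> has_dynkin_edge \<alpha> \<alpha>v (set u)" for u
      proof
        assume "N.word_act u m \<in> N_V"
        then have "(\<lambda>h. \<Lambda> h - word_weight \<alpha> u h) \<in> weights scale_h gen scale_M act_M N_V"
          unfolding N.weights_iff using lin word_nonzero word_wt by blast
        from bspec[OF edge this] show False using that unfolding supp by blast
      qed
    qed
    then obtain u where u: "count_list u = count_list w" "N.word_act u m \<notin> N_V" by blast
    \<comment> \<open>The weight depends on the exponents only, so the reordered word still has
      weight \<open>\<mu>\<close>.\<close>
    have "\<mu> = (\<lambda>h. \<Lambda> h - word_weight \<alpha> u h)" by (simp add: \<mu> word_weight_count_list u(1))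
    moreover have "p (N.word_act u m) \<noteq> 0" using u(2) ker by simp
    moreover have "V.weight_vector (\<lambda>h. \<Lambda> h - word_weight \<alpha> u h) (p (N.word_act u m))"
      unfolding p_word by (rule V.weight_vector_word_act[OF V.h_highest])
    ultimately show "\<mu> \<in> weights scale_h gen scale_V act_V UNIV"
      unfolding V.weights_iff using lin by auto
  qed
  moreover have "N.edge_weights N_V"
    if eq: "weights scale_h gen scale_V act_V UNIV = weights scale_h gen scale_M act_M UNIV"
  proof (intro ballI, rule ccontr)
    fix \<mu> assume "\<mu> \<in> weights scale_h gen scale_M act_M N_V"
      and no_edge: "\<not> has_dynkin_edge \<alpha> \<alpha>v (root_supp \<alpha> (\<lambda>h. \<Lambda> h - \<mu> h))"
    then obtain v where v: "v \<in> N_V" "v \<noteq> 0" "N.weight_vector \<mu> v"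
      and \<mu>lin: "linear_functional scale_h \<mu>" unfolding N.weights_iff by blast
    obtain w where \<mu>: "\<mu> = (\<lambda>h. \<Lambda> h - word_weight \<alpha> w h)"
      using N.weight_is_word_weight[OF v(3,2)] by blast
    have comm: "bracket (f i) (f j) = 0" if "i \<in> set w" "j \<in> set w" for i j
    proof (cases "i = j")
      case False
      then show ?thesis
        using no_edge that unfolding \<mu> supp has_dynkin_edge_def by (intro f_commute) auto
    qed (simp add: bracket_self)
    have same: "mset u = mset w" if "\<mu> = (\<lambda>h. \<Lambda> h - word_weight \<alpha> u h)" for u
      using that unfolding \<mu> by (intro word_weight_inject) (simp add: fun_eq_iff)
    \<comment> \<open>By independence of the roots all words of weight \<open>\<mu>\<close> are
      rearrangements of \<open>w\<close>, and commuting letters make them equal: the weight space is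
      a line.\<close>
    have "N.component \<mu> \<subseteq> N.M.span {N.word_act w m}"
      unfolding N.component_def
    proof (rule N.M.span_mono, rule subsetI)
      fix x assume "x \<in> {N.word_act u m | u. \<mu> = (\<lambda>h. \<Lambda> h - word_weight \<alpha> u h)}"
      then obtain u where "x = N.word_act u m" "\<mu> = (\<lambda>h. \<Lambda> h - word_weight \<alpha> u h)" by blast
      then show "x \<in> {N.word_act w m}" using N.words_commute[OF comm same] by simp
    qed
    then obtain k where k: "v = scale_M k (N.word_act w m)"
      using N.in_component[OF v(3)] by (auto simp: N.M.span_singleton)
    then have "k \<noteq> 0" using v(2) by auto
    moreover have "p v = 0" using ker v(1) by simp
    ultimately have pw: "V.word_act w (p m) = 0" by (simp add: k p.scale p_word)
    have "\<mu> \<in> weights scale_h gen scale_V act_V UNIV"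
      unfolding eq N.weights_iff using v \<mu>lin by blast
    then obtain y where y: "y \<noteq> 0" "V.weight_vector \<mu> y" unfolding V.weights_iff by blast
    \<comment> \<open>The same rearrangement in \<open>V\<close>, where the one available word is
      already zero, leaves no room for the weight vector \<open>y\<close>.\<close>
    have "V.component \<mu> \<subseteq> V.M.span {0}"
      unfolding V.component_def
    proof (rule V.M.span_mono, rule subsetI)
      fix x assume "x \<in> {V.word_act u (p m) | u. \<mu> = (\<lambda>h. \<Lambda> h - word_weight \<alpha> u h)}"
      then obtain u where "x = V.word_act u (p m)" "\<mu> = (\<lambda>h. \<Lambda> h - word_weight \<alpha> u h)" by blast
      then show "x \<in> {0}" using V.words_commute[OF comm same] pw by simp
    qed
    then have "y \<in> {0}" using V.in_component[OF y(2)] by auto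
    then show False using y(1) by simp
  qed
  ultimately show ?thesis by blast
qed

end
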